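(* Consider the planar map $F(x,y)=\left(y,-x+f(y)\right)$, where $f$ is a real rational function with $\deg(f)>1$. If $p$ is an elliptic fixed point of $F$, not $(2n+1)$-resonant, and such that its first non-vanishing Birkhoff constant is $B_n=i\,b_n$ for some $0<n\in\mathbb{N}$ and $b_n\in\mathbb{R}\setminus\{0\}$, then $F$ is not $\mathcal{C}^{2n+4}$-locally integrable at $p$.
   Context: For a rational function $f=P/Q$, with $P,Q$ polynomials, $\deg(f)=\deg(P)-\deg(Q)$. The map is considered where it is defined. Elliptic fixed point: a fixed point $p$ of $F$ such that the eigenvalues $\lambda,\bar\lambda=1/\lambda$ of $DF(p)$ lie on the unit circle of $\mathbb{C}$ and are different from $\pm1$. It is not $k$-resonant if $\lambda^\ell\neq 1$ for all $0<\ell\le k$. Birkhoff constants: near a not $k$-resonant elliptic fixed point, a $\mathcal{C}^{k}$ map $F$ is locally conjugate (moving $p$ to $0$, with $z=x+iy$) to its Birkhoff normal form $F_B(z)=\lambda z\bigl(1+\sum_{j=1}^{[(k-1)/2]}B_j (z\bar z)^j\bigr)+o(|z|^k)$, where $[\cdot]$ is the integer part; the $B_j\in\mathbb{C}$ are the Birkhoff constants. "The first non-vanishing Birkhoff constant is $B_n$" means $B_1=\dots=B_{n-1}=0$ and $B_n\ne0$ (here with $k=2n+1$). $\mathcal{C}^m$-locally integrable at an elliptic fixed point $p$ ($m\ge2$): there exist a neighborhood $\mathcal{U}$ of $p$ and a locally non-constant real valued function $V\in\mathcal{C}^m(\mathcal{U})$ (a first integral) such that $V(F(x))=V(x)$,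 all the level curves $\{V=h\}\cap\mathcal{U}$ are closed curves surrounding $p$ and, moreover, $p$ is an isolated non-degenerate critical point of $V$ in $\mathcal{U}$. *)

theory Defs
  imports "HOL-Analysis.Analysis" "HOL-Computational_Algebra.Polynomial"
    "HOL-Library.Landau_Symbols"
begin

(* f = P/Q.  HOL division is total, so the domain of the map is carried explicitly. *)

definition rat_degree :: "real poly \<Rightarrow> real poly \<Rightarrow> int" where
  "rat_degree P Q = int (degree P) - int (degree Q)"

definition rat_map :: "real poly \<Rightarrow> real poly \<Rightarrow> real^2 \<Rightarrow> real^2" where
  "rat_map P Q x = vector [x $ 2, - (x $ 1) + poly P (x $ 2) / poly Q (x $ 2)]"

definition rat_map_domain :: "real poly \<Rightarrow> (real^2) set" where
  "rat_map_domain Q = {x. poly Q (x $ 2) \<noteq> 0}"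

(* Meant for open S only: all derivatives are two-sided Frechet derivatives. *)
primrec Ck_on :: "nat \<Rightarrow> ('a::euclidean_space \<Rightarrow> 'b::euclidean_space) \<Rightarrow> 'a set \<Rightarrow> bool" where
  "Ck_on 0 f S \<longleftrightarrow> continuous_on S f"
| "Ck_on (Suc k) f S \<longleftrightarrow>
     (\<forall>x\<in>S. f differentiable (at x)) \<and>
     (\<forall>v. Ck_on k (\<lambda>x. frechet_derivative f (at x) v) S)"

definition complex_eigenvalues :: "real^'n^'n \<Rightarrow> complex set" where
  "complex_eigenvalues A =
     {\<mu>. \<exists>v. v \<noteq> 0 \<and> map_matrix complex_of_real A *v v = \<mu> *s v}"

definition elliptic_fixed_point ::
    "(real^2) set \<Rightarrow> (real^2 \<Rightarrow> real^2) \<Rightarrow> real^2 \<Rightarrow> complex \<Rightarrow> bool" where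
  "elliptic_fixed_point D F p \<mu> \<longleftrightarrow>
     p \<in> D \<and> F p = p \<and> F differentiable (at p) \<and>
     complex_eigenvalues (matrix (frechet_derivative F (at p))) = {\<mu>, cnj \<mu>} \<and>
     cmod \<mu> = 1 \<and> \<mu> \<noteq> 1 \<and> \<mu> \<noteq> - 1"

definition resonant :: "nat \<Rightarrow> complex \<Rightarrow> bool" where
  "resonant k \<mu> \<longleftrightarrow> (\<exists>l. 0 < l \<and> l \<le> k \<and> \<mu> ^ l = 1)"

(* A C^k change of coordinates h, with inverse g, carries (F, p) to (G, 0), where the plane
   is identified with the complex numbers by z = x + i y. *)
definition Ck_locally_conjugate ::
    "nat \<Rightarrow> (real^2 \<Rightarrow> real^2) \<Rightarrow> real^2 \<Rightarrow> (complex \<Rightarrow> complex) \<Rightarrow> bool" where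
  "Ck_locally_conjugate k F p G \<longleftrightarrow>
     (\<exists>U h g. open U \<and> p \<in> U \<and> open (h ` U) \<and> homeomorphism U (h ` U) h g \<and>
        Ck_on k h U \<and> Ck_on k g (h ` U) \<and> h p = 0 \<and>
        (\<forall>\<^sub>F x in nhds p. F x \<in> U \<and> h (F x) = G (h x)))"

definition birkhoff_normal_form ::
    "nat \<Rightarrow> complex \<Rightarrow> (nat \<Rightarrow> complex) \<Rightarrow> (complex \<Rightarrow> complex) \<Rightarrow> bool" where
  "birkhoff_normal_form k \<mu> B G \<longleftrightarrow>
     (\<lambda>z. G z - \<mu> * z * (1 + (\<Sum>j = 1..(k - 1) div 2. B j * (z * cnj z) ^ j)))
       \<in> o[at 0](\<lambda>z. complex_of_real (cmod z ^ k))"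

(* The constants depend on the chosen coordinates (a rescaling z -> c z multiplies the first
   non-zero one by a positive real), hence a relation rather than a function. *)
definition birkhoff_constants ::
    "nat \<Rightarrow> (real^2 \<Rightarrow> real^2) \<Rightarrow> real^2 \<Rightarrow> complex \<Rightarrow> (nat \<Rightarrow> complex) \<Rightarrow> bool" where
  "birkhoff_constants k F p \<mu> B \<longleftrightarrow>
     (\<exists>G. Ck_locally_conjugate k F p G \<and> birkhoff_normal_form k \<mu> B G)"

definition first_nonvanishing_birkhoff_constant ::
    "(real^2 \<Rightarrow> real^2) \<Rightarrow> real^2 \<Rightarrow> complex \<Rightarrow> nat \<Rightarrow> complex \<Rightarrow> bool" where
  "first_nonvanishing_birkhoff_constant F p \<mu> n \<beta> \<longleftrightarrow>
     (\<exists>B. birkhoff_constants (2 * n + 1) F p \<mu> B \<and>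
        (\<forall>j\<in>{1..<n}. B j = 0) \<and> B n = \<beta> \<and> \<beta> \<noteq> 0)"

definition critical_point :: "(real^2 \<Rightarrow> real) \<Rightarrow> real^2 \<Rightarrow> bool" where
  "critical_point V x \<longleftrightarrow> V differentiable (at x) \<and> frechet_derivative V (at x) = (\<lambda>v. 0)"

definition hessian :: "(real^2 \<Rightarrow> real) \<Rightarrow> real^2 \<Rightarrow> real^2^2" where
  "hessian V p = (\<chi> i j.
     frechet_derivative (\<lambda>x. frechet_derivative V (at x) (axis j 1)) (at p) (axis i 1))"

definition closed_curve_surrounding :: "(real^2) set \<Rightarrow> real^2 \<Rightarrow> bool" where
  "closed_curve_surrounding C p \<longleftrightarrow>
     (\<exists>\<gamma>. simple_path \<gamma> \<and> pathfinish \<gamma> = pathstart \<gamma> \<and> path_image \<gamma> = C \<and> p \<in> inside C)"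

(* A level set is empty for values not attained on U, and the level of p itself
   is the degenerate curve {p}. *)
definition locally_integrable_at ::
    "nat \<Rightarrow> (real^2) set \<Rightarrow> (real^2 \<Rightarrow> real^2) \<Rightarrow> real^2 \<Rightarrow> bool" where
  "locally_integrable_at m D F p \<longleftrightarrow>
     (\<exists>U V. open U \<and> p \<in> U \<and> Ck_on m V U \<and>
        (\<forall>W. open W \<and> W \<subseteq> U \<and> W \<noteq> {} \<longrightarrow> \<not> V constant_on W) \<and>
        (\<forall>x\<in>U \<inter> D. F x \<in> U \<longrightarrow> V (F x) = V x) \<and>
        (\<forall>h. {x \<in> U. V x = h} = {} \<or> {x \<in> U. V x = h} = {p} \<or>
             closed_curve_surrounding {x \<in> U. V x = h} p) \<and>
        p isolated_in {x \<in> U. critical_point V x} \<and>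
        det (hessian V p) \<noteq> 0)"

end

(* In Birkhoff coordinates a first integral W of F is a|z|^2 + o(|z|^2) up to a constant, since its
   Hessian is invariant under a rotation other than +-1; hence W is strictly monotone along rays
   near 0. As b is non-zero, the angle advanced by q iterations varies by more than 2 pi along
   each ray once q is large, so every ray carries a point whose q-th image lies on the same ray;
   W being preserved, that point is fixed by the q-th iterate. This gives infinitely many points
   of period q for F. But F has only finitely many: along an orbit P(y_i) = Q(y_i) (y_{i+1} +
   y_{i-1}), and deg P > deg Q + 1 makes the algebra of functions on the set of solutions of this
   cyclic system finite dimensional. *)

theory Submission
  imports Defs "HOL-Library.Function_Algebras" "HOL-Library.Multiset"
begin

text \<open>The normal form controls a single step near 0, while \<open>q\<close> has to be large,
  so an orbit might leave the controlled region before step \<open>q\<close>. The first integral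
  removes this obstacle too: \<open>W - W 0\<close> is comparable to |z|^2, so the modulus along an
  orbit stays within a factor 2 of its initial value for all time. The bounds on the rotation of one
  step then hold along the whole orbit and add up to bounds proportional to \<open>q\<close>, in a
  region fixed before \<open>q\<close> is chosen. For the intermediate value theorem the angle must
  not be reduced modulo 2 pi. It is taken as the imaginary part of a sum of terms
  \<open>Ln (G z / (\<mu> * z))\<close>, whose arguments avoid the slit. The expansion of
  \<open>W\<close> and its monotonicity along rays both come from the radial derivative
  \<open>W' z z\<close>. Since \<open>V\<close> is critical at \<open>p\<close>, the second
  derivative of the coordinate change contributes nothing to second order. On the algebraic side,
  finite dimension makes the powers of one coordinate linearly dependent on the solution set; the
  dependence is a nonzero polynomial that vanishes at all values of that coordinate.\<close>

section \<open>Real solutions of the cyclic polynomial system\<close>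

lemma finite_multisets_bounded_count:
  assumes "finite I"
  shows "finite {M. set_mset M \<subseteq> I \<and> (\<forall>i\<in>I. count M i < d)}" (is "finite ?B")
proof -
  have "inj_on (\<lambda>M. restrict (count M) I) ?B"
  proof (rule inj_onI)
    fix M N assume MN: "M \<in> ?B" "N \<in> ?B" and eq: "restrict (count M) I = restrict (count N) I"
    show "M = N"
    proof (rule multiset_eqI)
      fix i
      show "count M i = count N i"
      proof (cases "i \<in> I")
        case True
        then show ?thesis using fun_cong[OF eq, of i] by simp
      next
        case False
        then have "i \<notin># M" "i \<notin># N" using MN by auto
        then show ?thesis by (simp add: not_in_iff)
      qed
    qed
  qed
  moreover have "(\<lambda>M. restrict (count M) I) ` ?B \<subseteq> (I \<rightarrow>\<^sub>E {..<d})"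
    by auto
  moreover have "finite (I \<rightarrow>\<^sub>E {..<d})"
    using assms by (intro finite_PiE) auto
  ultimately show ?thesis
    by (meson finite_imageD finite_subset)
qed

text \<open>
  The relation rewrites the power of degree \<open>degree P\<close> of each coordinate into terms of lower
  total degree, so on the solution set all monomials are combinations of finitely many of them.
\<close>

lemma finite_coordinates_of_polynomial_recurrence:
  fixes P Q :: "real poly" and I :: "'i set"
  assumes fin: "finite I" and deg: "degree Q + 1 < degree P"
    and s: "\<And>i. i \<in> I \<Longrightarrow> s i \<in> I" and t: "\<And>i. i \<in> I \<Longrightarrow> t i \<in> I" and i0: "i0 \<in> I"
  defines "S \<equiv> {y :: 'i \<Rightarrow> real. \<forall>i\<in>I. poly P (y i) = poly Q (y i) * (y (s i) + y (t i))}"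
  shows "finite ((\<lambda>y. y i0) ` S)"
proof -
  interpret V: vector_space "\<lambda>(c::real) (f::('i \<Rightarrow> real) \<Rightarrow> real) x. c * f x"
    by standard (auto simp: fun_eq_iff algebra_simps)
  define d where "d = degree P"
  have P_nz: "coeff P d \<noteq> 0" using deg by (auto simp: d_def)
  \<comment> \<open>Monomials are cut off to 0 outside \<open>S\<close>, so that relations valid on
    \<open>S\<close> become equalities in the vector space of all functions.\<close>
  define e where "e M = (\<lambda>y. if y \<in> S then prod_mset (image_mset y M) else 0)" for M :: "'i multiset"
  define B where "B = {M. set_mset M \<subseteq> I \<and> (\<forall>i\<in>I. count M i < d)}"
  have finB: "finite B" unfolding B_def by (rule finite_multisets_bounded_count[OF fin])
  have sum_app: "sum g A y = (\<Sum>x\<in>A. g x y)" for g :: "'x \<Rightarrow> ('i \<Rightarrow> real) \<Rightarrow> real" and A y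
    by (induction A rule: infinite_finite_induct) auto
  have span: "e M \<in> V.span (e ` B)" if "set_mset M \<subseteq> I" for M
    using that
  proof (induction "size M" arbitrary: M rule: less_induct)
    case less
    show ?case
    proof (cases "M \<in> B")
      case True
      then show ?thesis by (intro V.span_base) auto
    next
      case False
      then obtain i where i: "i \<in> I" "d \<le> count M i"
        using less.prems by (auto simp: B_def not_less)
      define N where "N = M - replicate_mset d i"
      have MN: "M = N + replicate_mset d i"
        using i by (simp add: N_def count_le_replicate_mset_subset_eq)
      have N: "set_mset N \<subseteq> I" using less.prems MN by auto
      have size: "size M = size N + d" by (simp add: MN)
      \<comment> \<open>The monomials produced by \<open>Q(y_i) * (y_(s i) + y_(t i))\<close>,
        multiplied by the cofactor \<open>N\<close>. Their degree is at most
        \<open>size N + degree Q + 1\<close>, which is below \<open>size N + d = size M\<close>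
        exactly because of \<open>deg\<close>.\<close>
      define T where "T j k = e (N + replicate_mset j i + {#k#})" for j k
      have low: "e (N + replicate_mset j i) \<in> V.span (e ` B)" if "j < d" for j
        using that N i size by (intro less.hyps) auto
      have T: "T j k \<in> V.span (e ` B)" if "j \<le> degree Q" "k \<in> I" for j k
        using that N i size deg unfolding T_def
        by (intro less.hyps) (auto simp: d_def)
      define R where "R = (\<Sum>j\<le>degree Q. (\<lambda>y. coeff Q j * (T j (s i) + T j (t i)) y))
         - (\<Sum>j<d. (\<lambda>y. coeff P j * e (N + replicate_mset j i) y))"
      have "R \<in> V.span (e ` B)"
        unfolding R_def
        by (intro V.span_diff V.span_sum V.span_scale V.span_add T low) (use s t i in auto)
      moreover have "e M = (\<lambda>y. (1 / coeff P d) * R y)"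
      proof
        fix y
        show "e M y = (1 / coeff P d) * R y"
        proof (cases "y \<in> S")
          case True
          define c where "c = prod_mset (image_mset y N)"
          have "poly P (y i) = poly Q (y i) * (y (s i) + y (t i))"
            using True i by (auto simp: S_def)
          moreover have "poly P (y i) = (\<Sum>j<d. coeff P j * y i ^ j) + coeff P d * y i ^ d"
            by (simp add: poly_altdef d_def lessThan_Suc_atMost[symmetric])
          moreover have "poly Q (y i) = (\<Sum>j\<le>degree Q. coeff Q j * y i ^ j)"
            by (simp add: poly_altdef)
          ultimately have "coeff P d * y i ^ d = (\<Sum>j\<le>degree Q. coeff Q j * y i ^ j) * (y (s i) + y (t i))
             - (\<Sum>j<d. coeff P j * y i ^ j)" by simp
          moreover have "R y = ((\<Sum>j\<le>degree Q. coeff Q j * y i ^ j) * (y (s i) + y (t i))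
             - (\<Sum>j<d. coeff P j * y i ^ j)) * c"
            using True
            by (simp add: R_def sum_app T_def e_def c_def sum_distrib_left sum_distrib_right
                  sum.distrib algebra_simps)
          ultimately have "R y = coeff P d * y i ^ d * c" by simp
          then have "y i ^ d * c = (1 / coeff P d) * R y"
            using P_nz by (simp add: field_simps)
          then show ?thesis
            using True by (simp add: e_def MN c_def algebra_simps)
        next
          case False
          then show ?thesis by (simp add: e_def R_def sum_app T_def)
        qed
      qed
      ultimately show ?thesis by (metis V.span_scale)
    qed
  qed
  \<comment> \<open>The \<open>m + 1\<close> powers of coordinate \<open>i0\<close> lie in a space
    spanned by \<open>m\<close> functions.\<close>
  define m where "m = card (e ` B)"
  define v where "v k = e (replicate_mset k i0)" for k :: nat
  have v: "v k y = y i0 ^ k" if "y \<in> S" for k y using that by (simp add: v_def e_def)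
  have v_span: "v ` {..m} \<subseteq> V.span (e ` B)"
    using i0 by (auto simp: v_def intro!: span split: if_splits)
  have "\<exists>r :: real poly. r \<noteq> 0 \<and> (\<forall>y\<in>S. poly r (y i0) = 0)"
  \<comment> \<open>Dependence is a property of a set of vectors, so powers that coincide on
    \<open>S\<close> need separate treatment: they give the polynomial \<open>x^k - x^l\<close>
    directly.\<close>
  proof (cases "inj_on v {..m}")
    case False
    then obtain k l where kl: "k \<noteq> l" "v k = v l" by (auto simp: inj_on_def)
    show ?thesis
    proof (intro exI conjI ballI)
      show "monom (1::real) k - monom 1 l \<noteq> 0" using kl by (auto simp: monom_eq_iff')
      fix y assume "y \<in> S"
      then show "poly (monom 1 k - monom 1 l) (y i0) = 0"
        using v[of y k] v[of y l] kl by (simp add: poly_monom)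
    qed
  next
    case True
    then have "card (v ` {..m}) = Suc m" by (simp add: card_image)
    then have "V.dependent (v ` {..m})"
      using V.independent_span_bound[OF _ _ v_span] finB by (auto simp: m_def)
    then obtain u x where u: "(\<Sum>f\<in>v ` {..m}. (\<lambda>y. u f * f y)) = 0" and x: "x \<in> v ` {..m}" "u x \<noteq> 0"
      by (subst (asm) V.dependent_finite) auto
    from x obtain k where k: "k \<le> m" "u (v k) \<noteq> 0" by auto
    have u': "(\<Sum>j\<le>m. (\<lambda>y. u (v j) * v j y)) = 0"
      using u by (subst (asm) sum.reindex[OF True]) (simp add: comp_def)
    define r where "r = (\<Sum>j\<le>m. monom (u (v j)) j)"
    have "coeff r k = u (v k)" using k by (simp add: r_def coeff_sum)
    then have "r \<noteq> 0" using k by auto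
    moreover have "poly r (y i0) = 0" if "y \<in> S" for y
    proof -
      have "poly r (y i0) = (\<Sum>j\<le>m. u (v j) * v j y)"
        using v[OF that] by (simp add: r_def poly_sum poly_monom)
      also have "\<dots> = (\<Sum>j\<le>m. (\<lambda>y. u (v j) * v j y)) y" by (simp add: sum_app)
      finally show ?thesis using u' by simp
    qed
    ultimately show ?thesis by blast
  qed
  then obtain r :: "real poly" where "r \<noteq> 0" "\<forall>y\<in>S. poly r (y i0) = 0" by blast
  then show ?thesis
    by (intro finite_subset[OF _ poly_roots_finite[of r]]) auto
qed

section \<open>Symmetry of the second derivative at a point\<close>

text \<open>The mean value theorem in direction \<open>v\<close>, applied to the difference of
  \<open>V\<close> along two parallel segments, turns the numerator into
  \<open>s * (V' x v - V' y v)\<close> with \<open>x - y = s u\<close>. Both values of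
  \<open>V'\<close> are then expanded around \<open>p\<close>, so second-order information is needed
  at \<open>p\<close> only.\<close>

lemma second_difference_expansion:
  fixes V :: "'a::real_normed_vector \<Rightarrow> real"
  assumes dV: "eventually (\<lambda>x. (V has_derivative V' x) (at x)) (nhds p)"
    and D: "((\<lambda>x. V' x v) has_derivative D) (at p)"
  shows "((\<lambda>s. (V (p + s *\<^sub>R u + s *\<^sub>R v) - V (p + s *\<^sub>R u) - V (p + s *\<^sub>R v) + V p) / s\<^sup>2)
            \<longlongrightarrow> D u) (at_right 0)"
proof (rule tendstoI)
  fix e :: real assume "e > 0"
  \<comment> \<open>The two expansion errors are at most \<open>\<epsilon> * s\<close> times
    \<open>norm u + norm v\<close> and \<open>norm v\<close>; \<open>K\<close> exceeds their sum,
    and the added 1 makes it positive.\<close>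
  define K where "K = norm u + 2 * norm v + 1"
  define \<epsilon> where "\<epsilon> = e / (2 * K)"
  have K: "K > 0" by (simp add: K_def add_nonneg_pos)
  with \<open>e > 0\<close> have \<epsilon>: "\<epsilon> > 0" "\<epsilon> * K < e" by (simp_all add: \<epsilon>_def)
  interpret D: bounded_linear D using D by (rule has_derivative_bounded_linear)
  obtain d1 where d1: "d1 > 0" "\<And>x. norm (x - p) < d1 \<Longrightarrow> (V has_derivative V' x) (at x)"
    using dV by (auto simp: eventually_nhds_metric dist_norm)
  obtain d2 where d2: "d2 > 0"
      "\<And>x. norm (x - p) < d2 \<Longrightarrow> norm (V' x v - V' p v - D (x - p)) \<le> \<epsilon> * norm (x - p)"
    using D \<epsilon>(1) unfolding has_derivative_at_alt by blast
  define d where "d = min d1 d2 / K"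
  have d: "d > 0" using d1 d2 K by (simp add: d_def)
  show "eventually (\<lambda>s. dist ((V (p + s *\<^sub>R u + s *\<^sub>R v) - V (p + s *\<^sub>R u) - V (p + s *\<^sub>R v) + V p) / s\<^sup>2)
      (D u) < e) (at_right 0)"
    using eventually_at_right_less[of 0] eventually_at_right_real[OF d]
  proof eventually_elim
    case (elim s)
    then have s: "0 < s" "s < d" by auto
    have sK: "s * K < min d1 d2" using s K by (simp add: d_def field_simps)
    define \<psi> where "\<psi> \<tau> = V (p + s *\<^sub>R u + \<tau> *\<^sub>R s *\<^sub>R v) - V (p + \<tau> *\<^sub>R s *\<^sub>R v)" for \<tau>
    have near: "norm (s *\<^sub>R u + \<tau> *\<^sub>R s *\<^sub>R v) \<le> s * (norm u + norm v)"
       "norm (\<tau> *\<^sub>R s *\<^sub>R v) \<le> s * norm v" if "\<tau> \<in> {0..1}" for \<tau>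
    proof -
      have "\<tau> * (s * norm v) \<le> 1 * (s * norm v)"
        using that s by (intro mult_right_mono) auto
      then show "norm (\<tau> *\<^sub>R s *\<^sub>R v) \<le> s * norm v"
        using that s by simp
      then show "norm (s *\<^sub>R u + \<tau> *\<^sub>R s *\<^sub>R v) \<le> s * (norm u + norm v)"
        using norm_triangle_ineq[of "s *\<^sub>R u" "\<tau> *\<^sub>R s *\<^sub>R v"] s by (simp add: distrib_left)
    qed
    have bd: "s * (norm u + norm v) < min d1 d2" "s * norm v < min d1 d2"
      by (rule le_less_trans[OF _ sK], use s in \<open>simp add: K_def\<close>)+
    have der: "(\<psi> has_derivative (\<lambda>h. V' (p + s *\<^sub>R u + \<tau> *\<^sub>R s *\<^sub>R v) (h *\<^sub>R s *\<^sub>R v)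
                 - V' (p + \<tau> *\<^sub>R s *\<^sub>R v) (h *\<^sub>R s *\<^sub>R v))) (at \<tau>)" if "\<tau> \<in> {0..1}" for \<tau>
      unfolding \<psi>_def
    proof (intro has_derivative_diff)
      have chain: "((\<lambda>\<tau>. V (c + \<tau> *\<^sub>R w)) has_derivative (\<lambda>h. V' (c + \<tau> *\<^sub>R w) (h *\<^sub>R w))) (at \<tau>)"
        if "norm (c + \<tau> *\<^sub>R w - p) < d1" for c w
      proof -
        have "((\<lambda>\<tau>. c + \<tau> *\<^sub>R w) has_derivative (\<lambda>h. h *\<^sub>R w)) (at \<tau>)"
          by (auto intro!: derivative_eq_intros)
        from has_derivative_compose[OF this d1(2)[OF that]] show ?thesis .
      qed
      have n: "norm (p + s *\<^sub>R u + \<tau> *\<^sub>R s *\<^sub>R v - p) < d1" "norm (p + \<tau> *\<^sub>R s *\<^sub>R v - p) < d1"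
        using near[OF that] bd by (simp_all add: add.assoc)
      show "((\<lambda>\<tau>. V (p + s *\<^sub>R u + \<tau> *\<^sub>R s *\<^sub>R v)) has_derivative
          (\<lambda>h. V' (p + s *\<^sub>R u + \<tau> *\<^sub>R s *\<^sub>R v) (h *\<^sub>R s *\<^sub>R v))) (at \<tau>)"
        and "((\<lambda>\<tau>. V (p + \<tau> *\<^sub>R s *\<^sub>R v)) has_derivative
          (\<lambda>h. V' (p + \<tau> *\<^sub>R s *\<^sub>R v) (h *\<^sub>R s *\<^sub>R v))) (at \<tau>)"
        by (rule chain[OF n(1)], rule chain[OF n(2)])
    qed
    obtain \<tau> where \<tau>: "0 < \<tau>" "\<tau> < 1" and mvt: "\<psi> 1 - \<psi> 0 = V' (p + s *\<^sub>R u + \<tau> *\<^sub>R s *\<^sub>R v) ((1 - 0) *\<^sub>R s *\<^sub>R v)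
                 - V' (p + \<tau> *\<^sub>R s *\<^sub>R v) ((1 - 0) *\<^sub>R s *\<^sub>R v)"
    proof (rule mvt[of 0 1 \<psi> "\<lambda>\<tau> h. V' (p + s *\<^sub>R u + \<tau> *\<^sub>R s *\<^sub>R v) (h *\<^sub>R s *\<^sub>R v)
                 - V' (p + \<tau> *\<^sub>R s *\<^sub>R v) (h *\<^sub>R s *\<^sub>R v)"])
      show "continuous_on {0..1} \<psi>"
        by (intro continuous_at_imp_continuous_on ballI has_derivative_continuous[OF der])
    qed (use der in auto)
    then have \<tau>': "\<tau> \<in> {0..1}" by auto
    define x where "x = p + s *\<^sub>R u + \<tau> *\<^sub>R s *\<^sub>R v"
    define y where "y = p + \<tau> *\<^sub>R s *\<^sub>R v"
    have xy: "norm (x - p) \<le> s * (norm u + norm v)" "norm (y - p) \<le> s * norm v"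
      using near[OF \<tau>'] by (auto simp: x_def y_def algebra_simps)
    have "linear (V' x)" "linear (V' y)"
      using d1(2)[of x] d1(2)[of y] xy bd by (auto dest!: has_derivative_linear)
    then have \<psi>_diff: "\<psi> 1 - \<psi> 0 = s * (V' x v - V' y v)"
      using mvt by (simp add: x_def y_def linear_scale algebra_simps)
    have "\<bar>V' x v - V' p v - D (x - p)\<bar> \<le> \<epsilon> * norm (x - p)"
      "\<bar>V' y v - V' p v - D (y - p)\<bar> \<le> \<epsilon> * norm (y - p)"
      using d2(2)[of x] d2(2)[of y] xy bd by auto
    then have "\<bar>V' x v - V' p v - D (x - p)\<bar> \<le> \<epsilon> * (s * (norm u + norm v))"
      "\<bar>V' y v - V' p v - D (y - p)\<bar> \<le> \<epsilon> * (s * norm v)"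
      using mult_left_mono[OF xy(1), of \<epsilon>] mult_left_mono[OF xy(2), of \<epsilon>] \<epsilon> by linarith+
    moreover have "D (x - p) - D (y - p) = s * D u"
      by (simp add: x_def y_def D.add D.scaleR)
    ultimately have "\<bar>V' x v - V' y v - s * D u\<bar> \<le> \<epsilon> * (s * (norm u + norm v)) + \<epsilon> * (s * norm v)"
      by linarith
    also have "\<dots> \<le> s * (\<epsilon> * K)"
      using s \<epsilon> by (simp add: K_def algebra_simps)
    also have "\<dots> < s * e" using s \<epsilon> by simp
    finally have *: "\<bar>V' x v - V' y v - s * D u\<bar> < s * e" .
    have quot: "(\<psi> 1 - \<psi> 0) / s\<^sup>2 - D u = (V' x v - V' y v - s * D u) / s"
      unfolding \<psi>_diff using s by (simp add: field_simps power2_eq_square)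
    have "\<bar>(\<psi> 1 - \<psi> 0) / s\<^sup>2 - D u\<bar> < e"
      unfolding quot using * s by (simp add: abs_divide pos_divide_less_eq mult.commute)
    then show ?case
      by (simp add: dist_real_def \<psi>_def algebra_simps)
  qed
qed

text \<open>The second difference is unchanged when \<open>u\<close> and \<open>v\<close> are
  swapped, so its two limits agree. Symmetry is needed later because a vanishing quadratic form only
  kills the symmetric part of the Hessian.\<close>

lemma second_derivative_symmetric:
  fixes V :: "'a::real_normed_vector \<Rightarrow> real"
  assumes "eventually (\<lambda>x. (V has_derivative V' x) (at x)) (nhds p)"
    and "((\<lambda>x. V' x u) has_derivative Du) (at p)"
    and "((\<lambda>x. V' x v) has_derivative Dv) (at p)"
  shows "Du v = Dv u"
proof (rule tendsto_unique[OF _ second_difference_expansion[OF assms(1,2)]])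
  have eq: "V (p + s *\<^sub>R v + s *\<^sub>R u) - V (p + s *\<^sub>R v) - V (p + s *\<^sub>R u) + V p =
      V (p + s *\<^sub>R u + s *\<^sub>R v) - V (p + s *\<^sub>R u) - V (p + s *\<^sub>R v) + V p" for s
    by (simp add: algebra_simps)
  show "((\<lambda>s. (V (p + s *\<^sub>R v + s *\<^sub>R u) - V (p + s *\<^sub>R v) - V (p + s *\<^sub>R u) + V p) / s\<^sup>2)
      \<longlongrightarrow> Dv u) (at_right 0)"
    unfolding eq by (rule second_difference_expansion[OF assms(1,3)])
qed simp

section \<open>Second-order expansion from the radial derivative\<close>

lemma has_derivative_smallo:
  fixes f :: "'a::real_normed_field \<Rightarrow> real"
  assumes "(f has_derivative D) (at 0)"
  shows "(\<lambda>z. f z - f 0 - D z) \<in> o[at 0](\<lambda>z. norm z)"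
proof (rule landau_o.smallI)
  fix c :: real assume "c > 0"
  with assms obtain d where "d > 0" "\<And>z. norm z < d \<Longrightarrow> \<bar>f z - f 0 - D z\<bar> \<le> c * norm z"
    unfolding has_derivative_at_alt by (auto simp: real_norm_def)
  then show "eventually (\<lambda>z. norm (f z - f 0 - D z) \<le> c * norm (norm z)) (at 0)"
    by (auto simp: eventually_at dist_norm)
qed

lemma bounded_linear_bigo:
  assumes "bounded_linear (f :: 'a::real_normed_field \<Rightarrow> real)"
  shows "f \<in> O[F](\<lambda>z. norm z)"
proof -
  obtain K where "\<And>z. norm (f z) \<le> norm z * K"
    using bounded_linear.bounded[OF assms] by blast
  then show ?thesis by (intro bigoI[of _ K]) (auto simp: mult.commute)
qed

text \<open>This is the radial derivative of the composition of \<open>V\<close> and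
  \<open>g\<close>. As \<open>V'\<close> vanishes at \<open>g 0\<close>, \<open>V' (g z)\<close> is
  O(|z|); replacing \<open>g' z z\<close> by \<open>g' 0 z\<close>, an error of o(|z|), therefore
  costs only o(|z|^2).\<close>

lemma radial_derivative_expansion:
  fixes V :: "'b::euclidean_space \<Rightarrow> real" and g :: "complex \<Rightarrow> 'b"
  assumes g0: "(g has_derivative g' 0) (at 0)"
    and lin: "eventually (\<lambda>z. linear (g' z)) (at 0)"
    and cont: "\<And>v. isCont (\<lambda>z. g' z v) 0"
    and V': "eventually (\<lambda>z. linear (V' (g z))) (at 0)" "V' (g 0) = (\<lambda>_. 0)"
    and D: "\<And>b. b \<in> Basis \<Longrightarrow> ((\<lambda>x. V' x b) has_derivative D b) (at (g 0))"
  shows "(\<lambda>z. V' (g z) (g' z z) - (\<Sum>b\<in>Basis. (g' 0 z \<bullet> b) * D b (g' 0 z)))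
           \<in> o[at 0](\<lambda>z. (norm z)\<^sup>2)"
proof -
  have A: "bounded_linear (g' 0)" using g0 by (rule has_derivative_bounded_linear)
  have 1: "(\<lambda>z. (g' z z \<bullet> b) - (g' 0 z \<bullet> b)) \<in> o[at 0](\<lambda>z. norm z)" for b
  proof -
    have cmp: "(\<lambda>z. (g' z v - g' 0 v) \<bullet> b) \<in> o[at 0](\<lambda>z. 1::real)" for v
    proof (rule smalloI_tendsto)
      have "((\<lambda>z. (g' z v - g' 0 v) \<bullet> b) \<longlongrightarrow> (g' 0 v - g' 0 v) \<bullet> b) (at 0)"
        using cont[of v] unfolding isCont_def by (intro tendsto_intros)
      then show "((\<lambda>z. (g' z v - g' 0 v) \<bullet> b / 1) \<longlongrightarrow> 0) (at 0)" by simp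
    qed simp
    have re: "(\<lambda>z. Re z) \<in> O[at 0](\<lambda>z. norm z)" "(\<lambda>z. Im z) \<in> O[at 0](\<lambda>z. norm z)"
      by (intro bounded_linear_bigo bounded_linear_Re bounded_linear_Im)+
    \<comment> \<open>Continuity of \<open>g'\<close> is given for each fixed vector, so the moving
      vector \<open>z\<close> is split along 1 and \<open>\<i>\<close>.\<close>
    have "(\<lambda>z. Re z * ((g' z 1 - g' 0 1) \<bullet> b) + Im z * ((g' z \<i> - g' 0 \<i>) \<bullet> b))
            \<in> o[at 0](\<lambda>z. norm z * 1)"
      by (intro sum_in_smallo landau_o.big_small_mult re cmp)
    moreover have "eventually (\<lambda>z. (g' z z \<bullet> b) - (g' 0 z \<bullet> b) =
        Re z * ((g' z 1 - g' 0 1) \<bullet> b) + Im z * ((g' z \<i> - g' 0 \<i>) \<bullet> b)) (at 0)"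
      using lin
    proof eventually_elim
      case (elim z)
      have "f z = Re z *\<^sub>R f 1 + Im z *\<^sub>R f \<i>" if "linear f" for f :: "complex \<Rightarrow> 'b"
      proof -
        have "z = Re z *\<^sub>R 1 + Im z *\<^sub>R \<i>" by (simp add: complex_eq_iff)
        then have "f z = f (Re z *\<^sub>R 1 + Im z *\<^sub>R \<i>)" by simp
        also have "\<dots> = Re z *\<^sub>R f 1 + Im z *\<^sub>R f \<i>"
          using that by (simp add: linear_add linear_scale)
        finally show ?thesis .
      qed
      from this[OF elim] this[OF bounded_linear.linear[OF A]] show ?case
        by (simp add: inner_simps algebra_simps)
    qed
    ultimately show ?thesis by (simp add: landau_o.small.in_cong)
  qed
  have 2: "(\<lambda>z. V' (g z) b - D b (g' 0 z)) \<in> o[at 0](\<lambda>z. norm z)" if "b \<in> Basis" for b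
    using has_derivative_smallo[OF has_derivative_compose[OF g0 D[OF that]]] V'(2) by simp
  have 3: "(\<lambda>z. (g' z z \<bullet> b) * V' (g z) b - (g' 0 z \<bullet> b) * D b (g' 0 z)) \<in> o[at 0](\<lambda>z. (norm z)\<^sup>2)"
    if b: "b \<in> Basis" for b
  proof -
    have bl: "bounded_linear (\<lambda>z. D b (g' 0 z))"
      using has_derivative_bounded_linear[OF D[OF b]] A by (rule bounded_linear_compose)
    then have O1: "(\<lambda>z. D b (g' 0 z)) \<in> O[at 0](\<lambda>z. norm z)" by (rule bounded_linear_bigo)
    have O2: "(\<lambda>z. g' 0 z \<bullet> b) \<in> O[at 0](\<lambda>z. norm z)"
      by (intro bounded_linear_bigo bounded_linear_compose[OF bounded_linear_inner_left A])
    have O3: "(\<lambda>z. V' (g z) b) \<in> O[at 0](\<lambda>z. norm z)"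
      using sum_in_bigo(1)[OF landau_o.small_imp_big[OF 2[OF b]] O1] by simp
    \<comment> \<open>The error of a product, written as (a' - a) b' + a (b' - b).\<close>
    have "(\<lambda>z. ((g' z z \<bullet> b) - (g' 0 z \<bullet> b)) * V' (g z) b + (g' 0 z \<bullet> b) * (V' (g z) b - D b (g' 0 z)))
        \<in> o[at 0](\<lambda>z. norm z * norm z)"
      by (intro sum_in_smallo landau_o.small_big_mult landau_o.big_small_mult 1 2 O2 O3 b)
    then show ?thesis by (simp add: algebra_simps power2_eq_square)
  qed
  have "(\<lambda>z. \<Sum>b\<in>Basis. (g' z z \<bullet> b) * V' (g z) b - (g' 0 z \<bullet> b) * D b (g' 0 z))
      \<in> o[at 0](\<lambda>z. (norm z)\<^sup>2)"
    by (rule big_sum_in_smallo[OF 3])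
  moreover have "eventually (\<lambda>z. V' (g z) (g' z z) - (\<Sum>b\<in>Basis. (g' 0 z \<bullet> b) * D b (g' 0 z)) =
      (\<Sum>b\<in>Basis. (g' z z \<bullet> b) * V' (g z) b - (g' 0 z \<bullet> b) * D b (g' 0 z))) (at 0)"
    using V'(1)
  proof eventually_elim
    case (elim z)
    have "V' (g z) (g' z z) = V' (g z) (\<Sum>b\<in>Basis. (g' z z \<bullet> b) *\<^sub>R b)"
      by (simp add: euclidean_representation)
    also have "\<dots> = (\<Sum>b\<in>Basis. (g' z z \<bullet> b) * V' (g z) b)"
      using elim by (simp add: linear_sum linear_scale)
    finally show ?case by (simp add: sum_subtractf)
  qed
  ultimately show ?thesis by (simp add: landau_o.small.in_cong)
qed

lemma smallo_at_0E:
  fixes f :: "'a::real_normed_field \<Rightarrow> 'b::real_normed_field" and g :: "'a \<Rightarrow> 'b"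
  assumes "f \<in> o[at 0](g)" "c > 0"
  obtains d where "d > 0" "\<And>z. z \<noteq> 0 \<Longrightarrow> norm z < d \<Longrightarrow> norm (f z) \<le> c * norm (g z)"
  using landau_o.smallD[OF assms] by (auto simp: eventually_at dist_norm)

text \<open>Along the ray through \<open>z\<close>, \<open>t\<close> times the derivative of
  \<open>W (t z) - t^2 / 2 * q z\<close> is the radial error at \<open>t z\<close>, which is o(t^2
  |z|^2). The mean value theorem on [0, 1] transfers this to \<open>W\<close>; the factor 1/2 is
  that of integrating \<open>t * q z\<close>.\<close>

lemma radial_derivative_imp_expansion:
  fixes W :: "complex \<Rightarrow> real"
  assumes r: "r > 0" and dW: "\<And>z. z \<in> ball 0 r \<Longrightarrow> (W has_derivative W' z) (at z)"
    and rad: "(\<lambda>z. W' z z - q z) \<in> o[at 0](\<lambda>z. (norm z)\<^sup>2)"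
    and hom: "\<And>(t::real) z. q (t *\<^sub>R z) = t\<^sup>2 * q z"
  shows "(\<lambda>z. W z - W 0 - q z / 2) \<in> o[at 0](\<lambda>z. (norm z)\<^sup>2)"
proof (rule landau_o.smallI)
  fix c :: real assume c: "c > 0"
  obtain d where d: "d > 0" "\<And>z. z \<noteq> 0 \<Longrightarrow> norm z < d \<Longrightarrow> norm (W' z z - q z) \<le> c * norm ((norm z)\<^sup>2)"
    using smallo_at_0E[OF rad c] by blast
  have "norm (W z - W 0 - q z / 2) \<le> c * norm ((norm z)\<^sup>2)" if z: "z \<noteq> 0" "norm z < min d r" for z
  proof -
    define f where "f t = W (t *\<^sub>R z) - t\<^sup>2 / 2 * q z" for t :: real
    have small: "norm (t *\<^sub>R z) < min d r" if "t \<in> {0..1}" for t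
    proof -
      have "norm (t *\<^sub>R z) \<le> norm z" using that by (simp add: mult_left_le_one_le)
      then show ?thesis using z by linarith
    qed
    have der: "(f has_derivative (\<lambda>h. W' (t *\<^sub>R z) (h *\<^sub>R z) - h * t * q z)) (at t)"
      if "t \<in> {0..1}" for t
      unfolding f_def
    proof (intro has_derivative_diff)
      have "((\<lambda>t. t *\<^sub>R z) has_derivative (\<lambda>h. h *\<^sub>R z)) (at t)"
        by (auto intro!: derivative_eq_intros)
      moreover have "(W has_derivative W' (t *\<^sub>R z)) (at (t *\<^sub>R z))"
        using small[OF that] by (intro dW) simp
      ultimately show "((\<lambda>t. W (t *\<^sub>R z)) has_derivative (\<lambda>h. W' (t *\<^sub>R z) (h *\<^sub>R z))) (at t)"
        by (rule has_derivative_compose)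
      show "((\<lambda>t. t\<^sup>2 / 2 * q z) has_derivative (\<lambda>h. h * t * q z)) (at t)"
        by (auto intro!: derivative_eq_intros)
    qed
    obtain t where t: "0 < t" "t < 1" and mvt: "f 1 - f 0 = W' (t *\<^sub>R z) ((1 - 0) *\<^sub>R z) - (1 - 0) * t * q z"
    proof (rule mvt[of 0 1 f "\<lambda>t h. W' (t *\<^sub>R z) (h *\<^sub>R z) - h * t * q z"])
      show "continuous_on {0..1} f"
        by (intro continuous_at_imp_continuous_on ballI has_derivative_continuous[OF der])
    qed (use der in auto)
    have tz: "norm (t *\<^sub>R z) < min d r" using small t by auto
    have "linear (W' (t *\<^sub>R z))"
      using tz by (intro has_derivative_linear[OF dW]) simp
    moreover have f_diff: "f 1 - f 0 = W' (t *\<^sub>R z) z - t * q z" using mvt by simp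
    ultimately have "t * (f 1 - f 0) = W' (t *\<^sub>R z) (t *\<^sub>R z) - q (t *\<^sub>R z)"
      unfolding f_diff by (simp add: linear_scale hom power2_eq_square algebra_simps)
    then have "t * \<bar>f 1 - f 0\<bar> \<le> c * (norm (t *\<^sub>R z))\<^sup>2"
      using d(2)[of "t *\<^sub>R z"] tz t z by (simp add: abs_mult[symmetric])
    also have "\<dots> = t * (t * (c * (norm z)\<^sup>2))"
      by (simp add: power2_eq_square)
    finally have "\<bar>f 1 - f 0\<bar> \<le> t * (c * (norm z)\<^sup>2)" using t by simp
    also have "\<dots> \<le> 1 * (c * (norm z)\<^sup>2)"
      using t c by (intro mult_right_mono) auto
    finally show ?thesis by (simp add: f_def)
  qed
  then show "eventually (\<lambda>z. norm (W z - W 0 - q z / 2) \<le> c * norm ((norm z)\<^sup>2)) (at 0)"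
    using d r by (auto simp: eventually_at dist_norm intro!: exI[of _ "min d r"])
qed

text \<open>Near 0 the error is at most half of the leading term, so \<open>W' z z\<close> has no
  zero there, and Rolle's theorem excludes equal values on a ray. The same \<open>d\<close> serves
  all directions.\<close>

lemma radial_derivative_imp_inj_on_rays:
  fixes W :: "complex \<Rightarrow> real"
  assumes r: "r > 0" and dW: "\<And>z. z \<in> ball 0 r \<Longrightarrow> (W has_derivative W' z) (at z)"
    and rad: "(\<lambda>z. W' z z - c * (norm z)\<^sup>2) \<in> o[at 0](\<lambda>z. (norm z)\<^sup>2)" and c: "c \<noteq> 0"
  obtains d where "d > 0" "\<And>u. norm u = 1 \<Longrightarrow> inj_on (\<lambda>t. W (t *\<^sub>R u)) {0<..<d}"
proof -
  obtain d where d: "d > 0" "\<And>z. z \<noteq> 0 \<Longrightarrow> norm z < d \<Longrightarrow>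
      norm (W' z z - c * (norm z)\<^sup>2) \<le> \<bar>c\<bar> / 2 * norm ((norm z)\<^sup>2)"
    using smallo_at_0E[OF rad, of "\<bar>c\<bar> / 2"] c by auto
  have nz: "W' z z \<noteq> 0" if "z \<noteq> 0" "norm z < d" for z
  proof
    assume "W' z z = 0"
    then have "\<bar>c\<bar> * (norm z)\<^sup>2 \<le> \<bar>c\<bar> / 2 * (norm z)\<^sup>2" using d(2)[OF that] by (simp add: abs_mult)
    moreover have "\<bar>c\<bar> * (norm z)\<^sup>2 > 0" using c that by simp
    ultimately show False by simp
  qed
  have ne: "W (s *\<^sub>R u) \<noteq> W (t *\<^sub>R u)" if u: "norm u = 1" and st: "0 < s" "s < t" "t < min d r" for u s t
  proof
    assume eq: "W (s *\<^sub>R u) = W (t *\<^sub>R u)"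
    have der: "((\<lambda>t. W (t *\<^sub>R u)) has_derivative (\<lambda>h. W' (x *\<^sub>R u) (h *\<^sub>R u))) (at x)"
      if "s \<le> x" "x \<le> t" for x
    proof -
      have "((\<lambda>t. t *\<^sub>R u) has_derivative (\<lambda>h. h *\<^sub>R u)) (at x)"
        by (auto intro!: derivative_eq_intros)
      moreover have "(W has_derivative W' (x *\<^sub>R u)) (at (x *\<^sub>R u))"
        using that st u by (intro dW) simp
      ultimately show ?thesis by (rule has_derivative_compose)
    qed
    have "\<exists>x. s < x \<and> x < t \<and> (\<lambda>h. W' (x *\<^sub>R u) (h *\<^sub>R u)) = (\<lambda>v. 0)"
    proof (rule Rolle_deriv[OF \<open>s < t\<close> eq])
      show "continuous_on {s..t} (\<lambda>t. W (t *\<^sub>R u))"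
        by (intro continuous_at_imp_continuous_on ballI has_derivative_continuous[OF der]) auto
    qed (use der in auto)
    then obtain x where x: "s < x" "x < t" "(\<lambda>h. W' (x *\<^sub>R u) (h *\<^sub>R u)) = (\<lambda>v. 0)" by blast
    have "W' (x *\<^sub>R u) (x *\<^sub>R u) = 0" using fun_cong[OF x(3), of x] by simp
    moreover have "x *\<^sub>R u \<noteq> 0" "norm (x *\<^sub>R u) < d" using x st u by auto
    ultimately show False using nz by blast
  qed
  show ?thesis
  proof
    show "min d r > 0" using d r by simp
    fix u :: complex assume "norm u = 1"
    then show "inj_on (\<lambda>t. W (t *\<^sub>R u)) {0<..<min d r}"
      using ne[of u] by (intro linorder_inj_onI) auto
  qed
qed

section \<open>The leading quadratic form is a multiple of |z|^2\<close>

lemma smallo_square_along_curve: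
  fixes E :: "complex \<Rightarrow> real" and w :: "real \<Rightarrow> complex"
  assumes E: "E \<in> o[at 0](\<lambda>z. (norm z)\<^sup>2)" and E0: "E 0 = 0"
    and w: "((\<lambda>t. w t /\<^sub>R t) \<longlongrightarrow> l) (at_right 0)"
  shows "((\<lambda>t. E (w t) / t\<^sup>2) \<longlongrightarrow> 0) (at_right 0)"
proof -
  \<comment> \<open>Division by zero gives \<open>\<phi> 0 = 0\<close>, which is the limit, so
    \<open>\<phi>\<close> is continuous at 0 even if the curve \<open>w\<close> passes through
    0.\<close>
  define \<phi> where "\<phi> z = E z / (norm z)\<^sup>2" for z
  have "(\<phi> \<longlongrightarrow> 0) (at 0)" unfolding \<phi>_def by (rule smalloD_tendsto[OF E])
  then have cont: "isCont \<phi> 0" by (simp add: isCont_def \<phi>_def)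
  have "((\<lambda>t. t *\<^sub>R (w t /\<^sub>R t)) \<longlongrightarrow> 0) (at_right 0)"
    using tendsto_scaleR[OF tendsto_ident_at w] by (simp only: scaleR_zero_left)
  then have "(w \<longlongrightarrow> 0) (at_right 0)"
  proof (rule Lim_transform_eventually)
    show "eventually (\<lambda>t. t *\<^sub>R (w t /\<^sub>R t) = w t) (at_right 0)"
      using eventually_at_right_less[of "0::real"] by eventually_elim simp
  qed
  then have "((\<lambda>t. \<phi> (w t)) \<longlongrightarrow> \<phi> 0) (at_right 0)"
    by (rule isCont_tendsto_compose[OF cont])
  then have "((\<lambda>t. \<phi> (w t) * (norm (w t /\<^sub>R t))\<^sup>2) \<longlongrightarrow> \<phi> 0 * (norm l)\<^sup>2) (at_right 0)"
    by (intro tendsto_mult tendsto_power tendsto_norm w)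
  then have "((\<lambda>t. \<phi> (w t) * (norm (w t /\<^sub>R t))\<^sup>2) \<longlongrightarrow> 0) (at_right 0)"
    by (simp add: \<phi>_def E0)
  then show ?thesis
  proof (rule Lim_transform_eventually)
    show "eventually (\<lambda>t. \<phi> (w t) * (norm (w t /\<^sub>R t))\<^sup>2 = E (w t) / t\<^sup>2) (at_right 0)"
      using eventually_at_right_less[of "0::real"]
    proof eventually_elim
      case (elim t)
      then show ?case
        by (cases "w t = 0") (simp_all add: \<phi>_def E0 power_mult_distrib power_inverse divide_inverse)
    qed
  qed
qed

text \<open>Blow-up at 0: divide \<open>W (G (t z)) = W (t z)\<close> by \<open>t^2\<close> and let
  \<open>t\<close> tend to 0, where \<open>G (t z) / t\<close> tends to
  \<open>\<mu> * z\<close>.\<close>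

lemma leading_form_invariant:
  fixes W q :: "complex \<Rightarrow> real" and G :: "complex \<Rightarrow> complex"
  assumes q: "continuous_on UNIV q" and hom: "\<And>(t::real) z. q (t *\<^sub>R z) = t\<^sup>2 * q z"
    and W: "(\<lambda>z. W z - W 0 - q z / 2) \<in> o[at 0](\<lambda>z. (norm z)\<^sup>2)"
    and inv: "eventually (\<lambda>z. W (G z) = W z) (at 0)"
    and G: "(\<lambda>z. G z - \<mu> * z) \<in> o[at 0](\<lambda>z. z)"
  shows "q (\<mu> * z) = q z"
proof (cases "z = 0")
  case False
  define E where "E z = W z - W 0 - q z / 2" for z
  have E: "E \<in> o[at 0](\<lambda>z. (norm z)\<^sup>2)" unfolding E_def by (rule W)
  have E0: "E 0 = 0" using hom[of 0 0] by (simp add: E_def)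
  have "((\<lambda>t. t *\<^sub>R z) \<longlongrightarrow> 0 *\<^sub>R z) (at_right (0::real))" by (intro tendsto_intros)
  then have lim0: "filterlim (\<lambda>t. t *\<^sub>R z) (at 0) (at_right (0::real))"
    unfolding filterlim_at using False
    by (auto simp: eventually_at_right_less eventually_at_filter)
  have tz: "((\<lambda>t. (t *\<^sub>R z) /\<^sub>R t) \<longlongrightarrow> z) (at_right 0)"
  proof (rule tendsto_eventually)
    show "eventually (\<lambda>t. (t *\<^sub>R z) /\<^sub>R t = z) (at_right 0)"
      using eventually_at_right_less[of "0::real"] by eventually_elim simp
  qed
  have "((\<lambda>t. (G (t *\<^sub>R z) - \<mu> * (t *\<^sub>R z)) / (t *\<^sub>R z) * z + \<mu> * z) \<longlongrightarrow> 0 * z + \<mu> * z) (at_right 0)"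
    by (intro tendsto_add tendsto_const tendsto_mult_right filterlim_compose[OF smalloD_tendsto[OF G] lim0])
  then have Gt: "((\<lambda>t. G (t *\<^sub>R z) /\<^sub>R t) \<longlongrightarrow> \<mu> * z) (at_right 0)"
    unfolding mult_zero_left add_0_left
  proof (rule Lim_transform_eventually)
    show "eventually (\<lambda>t. (G (t *\<^sub>R z) - \<mu> * (t *\<^sub>R z)) / (t *\<^sub>R z) * z + \<mu> * z = G (t *\<^sub>R z) /\<^sub>R t) (at_right 0)"
      using eventually_at_right_less[of "0::real"]
      by eventually_elim (use False in \<open>auto simp: field_simps scaleR_conv_of_real\<close>)
  qed
  have lim1: "((\<lambda>t. q (G (t *\<^sub>R z) /\<^sub>R t) + 2 * (E (G (t *\<^sub>R z)) / t\<^sup>2)) \<longlongrightarrow> q (\<mu> * z) + 2 * 0) (at_right 0)"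
    using continuous_on_tendsto_compose[OF q Gt]
    by (intro tendsto_add tendsto_mult_left smallo_square_along_curve[OF E E0 Gt]) simp
  have "((\<lambda>t. q z + 2 * (E (t *\<^sub>R z) / t\<^sup>2)) \<longlongrightarrow> q z + 2 * 0) (at_right 0)"
    by (intro tendsto_add tendsto_const tendsto_mult_left smallo_square_along_curve[OF E E0 tz])
  then have lim2: "((\<lambda>t. q (G (t *\<^sub>R z) /\<^sub>R t) + 2 * (E (G (t *\<^sub>R z)) / t\<^sup>2)) \<longlongrightarrow> q z + 2 * 0) (at_right 0)"
  proof (rule Lim_transform_eventually)
    show "eventually (\<lambda>t. q z + 2 * (E (t *\<^sub>R z) / t\<^sup>2) =
        q (G (t *\<^sub>R z) /\<^sub>R t) + 2 * (E (G (t *\<^sub>R z)) / t\<^sup>2)) (at_right 0)"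
      using eventually_at_right_less[of "0::real"] eventually_compose_filterlim[OF inv lim0]
    proof eventually_elim
      case (elim t)
      have "q (t *\<^sub>R z) + 2 * E (t *\<^sub>R z) = q (G (t *\<^sub>R z)) + 2 * E (G (t *\<^sub>R z))"
        using elim(2) by (simp add: E_def)
      moreover have "q (G (t *\<^sub>R z)) = t\<^sup>2 * q (G (t *\<^sub>R z) /\<^sub>R t)"
        using elim(1) by (simp add: hom[symmetric])
      ultimately have "t\<^sup>2 * (q z + 2 * (E (t *\<^sub>R z) / t\<^sup>2)) =
          t\<^sup>2 * (q (G (t *\<^sub>R z) /\<^sub>R t) + 2 * (E (G (t *\<^sub>R z)) / t\<^sup>2))"
        using elim(1) hom[of t z] by (simp add: distrib_left)
      then show ?case using elim(1) by simp
    qed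
  qed
  show ?thesis using tendsto_unique[OF _ lim1 lim2] by simp
qed simp

text \<open>A quadratic form is a multiple of |z|^2 plus Re(beta z^2), and the rotation multiplies
  beta by \<open>\<mu>^2\<close>, which is not 1. In real terms, invariance at 1 and at 1 +
  \<open>\<i>\<close> gives, after division by \<open>s\<close>, two linear equations for
  \<open>b\<close> and \<open>c - a\<close> with determinant \<open>k^2 + s^2 = 1\<close>.\<close>

lemma rotation_invariant_quadratic_form:
  fixes \<mu> :: complex and a b c :: real
  defines "q \<equiv> \<lambda>z. a * (Re z)\<^sup>2 + b * Re z * Im z + c * (Im z)\<^sup>2"
  assumes inv: "\<And>z. q (\<mu> * z) = q z" and \<mu>: "cmod \<mu> = 1" "\<mu> \<noteq> 1" "\<mu> \<noteq> - 1"
  shows "q z = a * (cmod z)\<^sup>2"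
proof -
  define k s where "k = Re \<mu>" and "s = Im \<mu>"
  have ks: "k\<^sup>2 + s\<^sup>2 = 1" using \<mu>(1) cmod_power2[of \<mu>] by (simp add: k_def s_def)
  have s: "s \<noteq> 0"
  proof
    assume "s = 0"
    then have "k = 1 \<or> k = -1" using ks by (simp add: power2_eq_1_iff)
    then show False using \<mu>(2,3) \<open>s = 0\<close> by (auto simp: k_def s_def complex_eq_iff)
  qed
  have k2: "k\<^sup>2 = 1 - s\<^sup>2" using ks by simp
  have "a * k\<^sup>2 + b * k * s + c * s\<^sup>2 = a"
    using inv[of 1] by (simp add: q_def k_def s_def)
  then have "s * (b * k + (c - a) * s) = 0"
    unfolding k2 by (simp add: algebra_simps power2_eq_square)
  then have 1: "b * k + (c - a) * s = 0" using s by simp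
  have "a * (k - s)\<^sup>2 + b * (k - s) * (k + s) + c * (k + s)\<^sup>2 = a + b + c"
    using inv[of "Complex 1 1"] by (simp add: q_def k_def s_def add.commute)
  then have "a * (k\<^sup>2 + s\<^sup>2) + c * (k\<^sup>2 + s\<^sup>2) + b * (k\<^sup>2 - s\<^sup>2) + 2 * s * k * (c - a) = a + b + c"
    by (simp add: algebra_simps power2_eq_square)
  then have "2 * s * (k * (c - a) - s * b) = 0"
    unfolding ks unfolding k2 by (simp add: algebra_simps power2_eq_square)
  then have 2: "k * (c - a) - s * b = 0" using s by simp
  have "b * (k\<^sup>2 + s\<^sup>2) = k * (b * k + (c - a) * s) - s * (k * (c - a) - s * b)"
    by (simp add: algebra_simps power2_eq_square)
  then have b: "b = 0" using 1 2 ks by simp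
  then have "c = a" using 1 s by simp
  with b show ?thesis
    by (simp add: q_def cmod_power2 distrib_left)
qed

section \<open>Twist maps with a first integral have many periodic points\<close>

text \<open>With \<open>d < 1\<close> the point \<open>1 + x\<close> also avoids the slit and has
  modulus below 2; both facts are used for the normal form.\<close>

lemma Ln_approx_near_1:
  assumes "e > 0"
  obtains d where "0 < d" "d < 1" "\<And>x :: complex. norm x < d \<Longrightarrow> norm (Ln (1 + x) - x) \<le> e * norm x"
proof -
  have "(Ln has_field_derivative 1) (at 1)"
    using has_field_derivative_Ln[of 1] by simp
  then obtain d where d: "d > 0"
      "\<And>y. norm (y - 1) < d \<Longrightarrow> norm (Ln y - Ln 1 - 1 * (y - 1)) \<le> e * norm (y - (1::complex))"
    using assms unfolding has_field_derivative_def has_derivative_at_alt by blast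
  show ?thesis
  proof
    show "0 < min d (1/2)" "min d (1/2) < 1" using d by auto
    show "norm (Ln (1 + x) - x) \<le> e * norm x" if "norm x < min d (1/2)" for x :: complex
      using d(2)[of "1 + x"] that by simp
  qed
qed

text \<open>The logarithm records one step: its real part is the logarithm of the change of modulus,
  its imaginary part the rotation in addition to that of \<open>\<mu>\<close>. The quotient is
  \<open>1 + x z\<close> with \<open>x z\<close> close to \<open>\<i> b |z|^(2n)\<close>, and
  \<open>Ln (1 + x)\<close> is close to \<open>x\<close>.\<close>

lemma normal_form_logarithm:
  fixes G :: "complex \<Rightarrow> complex" and b :: real
  assumes \<mu>: "cmod \<mu> = 1" and n: "n > 0" and b: "b \<noteq> 0"
    and nf: "(\<lambda>z. G z - \<mu> * z * (1 + \<i> * of_real b * of_real (cmod z ^ (2 * n))))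
               \<in> o[at 0](\<lambda>z. complex_of_real (cmod z ^ (2 * n + 1)))"
  obtains d where "d > 0"
    and "\<And>z. z \<noteq> 0 \<Longrightarrow> cmod z < d \<Longrightarrow> G z / (\<mu> * z) \<notin> \<real>\<^sub>\<le>\<^sub>0"
    and "\<And>z. z \<noteq> 0 \<Longrightarrow> cmod z < d \<Longrightarrow> cmod (G z) \<le> 2 * cmod z"
    and "\<And>z. z \<noteq> 0 \<Longrightarrow> cmod z < d \<Longrightarrow>
           cmod (Ln (G z / (\<mu> * z)) - \<i> * of_real b * of_real (cmod z ^ (2 * n)))
              \<le> \<bar>b\<bar> / 2 * cmod z ^ (2 * n)"
proof -
  obtain \<delta> where \<delta>: "0 < \<delta>" "\<delta> < 1"
      "\<And>x :: complex. norm x < \<delta> \<Longrightarrow> norm (Ln (1 + x) - x) \<le> 1 / 8 * norm x"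
    using Ln_approx_near_1[of "1/8"] by auto
  \<comment> \<open>The constants 1/4 here and 1/8 above give |x| at most 5/4 |b| |z|^(2n) and a
    total error factor 1/4 + 5/32, which is below 1/2.\<close>
  obtain d1 where d1: "d1 > 0" "\<And>z. z \<noteq> 0 \<Longrightarrow> norm z < d1 \<Longrightarrow>
     cmod (G z - \<mu> * z * (1 + \<i> * of_real b * of_real (cmod z ^ (2 * n)))) \<le> \<bar>b\<bar> / 4 * cmod z ^ (2 * n + 1)"
    using smallo_at_0E[OF nf, of "\<bar>b\<bar> / 4"] b
    by (auto simp: norm_power norm_mult)
  have "((\<lambda>z. 2 * \<bar>b\<bar> * cmod z ^ (2 * n)) \<longlongrightarrow> 2 * \<bar>b\<bar> * cmod 0 ^ (2 * n)) (at 0)"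
    by (intro tendsto_intros)
  then have "eventually (\<lambda>z. 2 * \<bar>b\<bar> * cmod z ^ (2 * n) < \<delta>) (at 0)"
    by (rule order_tendstoD(2)) (use n \<delta> in \<open>simp add: power_0_left\<close>)
  then obtain d2 where d2: "d2 > 0" "\<And>z. z \<noteq> 0 \<Longrightarrow> cmod z < d2 \<Longrightarrow> 2 * \<bar>b\<bar> * cmod z ^ (2 * n) < \<delta>"
    by (auto simp: eventually_at dist_norm)
  define x where "x z = G z / (\<mu> * z) - 1" for z
  have x: "cmod (x z - \<i> * of_real b * of_real (cmod z ^ (2 * n))) \<le> \<bar>b\<bar> / 4 * cmod z ^ (2 * n)"
    if z: "z \<noteq> 0" "cmod z < min d1 d2" for z
  proof -
    have "\<mu> \<noteq> 0" using \<mu> by auto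
    have "x z - \<i> * of_real b * of_real (cmod z ^ (2 * n)) =
       (G z - \<mu> * z * (1 + \<i> * of_real b * of_real (cmod z ^ (2 * n)))) / (\<mu> * z)"
      using z \<open>\<mu> \<noteq> 0\<close> by (simp add: x_def field_simps)
    also have "cmod \<dots> = cmod (G z - \<mu> * z * (1 + \<i> * of_real b * of_real (cmod z ^ (2 * n)))) / cmod z"
      by (simp add: norm_divide norm_mult \<mu>)
    also have "\<dots> \<le> \<bar>b\<bar> / 4 * cmod z ^ (2 * n + 1) / cmod z"
      using z by (intro divide_right_mono d1(2)) auto
    finally show ?thesis using z by simp
  qed
  have x': "cmod (x z) \<le> 5 / 4 * \<bar>b\<bar> * cmod z ^ (2 * n)" "cmod (x z) < \<delta>"
    if z: "z \<noteq> 0" "cmod z < min d1 d2" for z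
  proof -
    have "cmod (\<i> * of_real b * of_real (cmod z ^ (2 * n))) = \<bar>b\<bar> * cmod z ^ (2 * n)"
      by (simp add: norm_mult norm_power)
    then show 1: "cmod (x z) \<le> 5 / 4 * \<bar>b\<bar> * cmod z ^ (2 * n)"
      using x[OF z] norm_triangle_sub[of "x z" "\<i> * of_real b * of_real (cmod z ^ (2 * n))"] by linarith
    have "0 \<le> \<bar>b\<bar> * cmod z ^ (2 * n)" by simp
    then show "cmod (x z) < \<delta>" using 1 d2(2)[of z] z by linarith
  qed
  have eq: "G z / (\<mu> * z) = 1 + x z" for z by (simp add: x_def)
  show ?thesis
  proof
    show "min d1 d2 > 0" using d1 d2 by simp
    fix z :: complex assume z: "z \<noteq> 0" "cmod z < min d1 d2"
    have "\<bar>Re (x z)\<bar> < 1" using abs_Re_le_cmod[of "x z"] x'(2)[OF z] \<delta> by linarith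
    then show "G z / (\<mu> * z) \<notin> \<real>\<^sub>\<le>\<^sub>0" unfolding eq by (auto simp: complex_nonpos_Reals_iff)
    have "cmod (1 + x z) \<le> 2" using norm_triangle_ineq[of 1 "x z"] x'(2)[OF z] \<delta> by simp
    moreover have "G z = \<mu> * z * (1 + x z)" using z \<mu> by (auto simp: x_def)
    ultimately show "cmod (G z) \<le> 2 * cmod z"
      by (simp add: norm_mult \<mu> mult.commute mult_left_mono)
    have "cmod (Ln (1 + x z) - x z) \<le> 1 / 8 * cmod (x z)" using \<delta>(3) x'(2)[OF z] .
    moreover have "cmod (Ln (1 + x z) - \<i> * of_real b * of_real (cmod z ^ (2 * n)))
        \<le> cmod (Ln (1 + x z) - x z) + cmod (x z - \<i> * of_real b * of_real (cmod z ^ (2 * n)))"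
      using norm_triangle_ineq[of "Ln (1 + x z) - x z"] by (metis diff_add_cancel add_diff_eq)
    moreover have "0 \<le> \<bar>b\<bar> * cmod z ^ (2 * n)" by simp
    ultimately show "cmod (Ln (G z / (\<mu> * z)) - \<i> * of_real b * of_real (cmod z ^ (2 * n)))
              \<le> \<bar>b\<bar> / 2 * cmod z ^ (2 * n)"
      unfolding eq using x[OF z] x'(1)[OF z] by linarith
  qed
qed

text \<open>On every ray some point is rotated by \<open>q\<close> steps exactly back to the ray,
  and invariance of \<open>W\<close> makes it fixed. The conclusion keeps the whole orbit in the
  ball, as is required to carry it through a local conjugacy.\<close>

lemma twist_map_infinite_periodic_points:
  fixes G :: "complex \<Rightarrow> complex" and W :: "complex \<Rightarrow> real" and a b r :: real
  assumes \<mu>: "cmod \<mu> = 1" and n: "n > 0" and b: "b \<noteq> 0" and r: "r > 0" and a: "a \<noteq> 0"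
    and cont: "continuous_on (ball 0 r) G"
    and nf: "(\<lambda>z. G z - \<mu> * z * (1 + \<i> * of_real b * of_real (cmod z ^ (2 * n))))
               \<in> o[at 0](\<lambda>z. complex_of_real (cmod z ^ (2 * n + 1)))"
    and inv: "\<And>z. z \<in> ball 0 r \<Longrightarrow> W (G z) = W z"
    and W: "(\<lambda>z. W z - W 0 - a * (cmod z)\<^sup>2) \<in> o[at 0](\<lambda>z. (cmod z)\<^sup>2)"
    and inj: "\<And>u. cmod u = 1 \<Longrightarrow> inj_on (\<lambda>t. W (t *\<^sub>R u)) {0<..<r}"
  obtains q where "q > 0" "infinite {z. (\<forall>k. (G ^^ k) z \<in> ball 0 r) \<and> (G ^^ q) z = z}"
proof -
  \<comment> \<open>Multiplying angles by the sign of \<open>b\<close> makes every rotation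
    positive, so both directions are treated at once.\<close>
  define \<sigma> where "\<sigma> = sgn b"
  have \<sigma>: "\<sigma> * b = \<bar>b\<bar>" "\<bar>\<sigma>\<bar> = 1" "\<sigma> * \<sigma> = 1" "\<sigma> = 1 \<or> \<sigma> = -1"
    using b by (auto simp: \<sigma>_def sgn_real_def)
  have \<mu>0: "\<mu> \<noteq> 0" using \<mu> by auto
  define L where "L z = Ln (G z / (\<mu> * z))" for z
  obtain d1 where d1: "d1 > 0"
    and slit: "\<And>z. z \<noteq> 0 \<Longrightarrow> cmod z < d1 \<Longrightarrow> G z / (\<mu> * z) \<notin> \<real>\<^sub>\<le>\<^sub>0"
    and Gle: "\<And>z. z \<noteq> 0 \<Longrightarrow> cmod z < d1 \<Longrightarrow> cmod (G z) \<le> 2 * cmod z"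
    and Lb: "\<And>z. z \<noteq> 0 \<Longrightarrow> cmod z < d1 \<Longrightarrow>
           cmod (L z - \<i> * of_real b * of_real (cmod z ^ (2 * n))) \<le> \<bar>b\<bar> / 2 * cmod z ^ (2 * n)"
    using normal_form_logarithm[OF \<mu> n b nf] unfolding L_def by blast
  obtain d2 where d2: "d2 > 0" "\<And>z. z \<noteq> 0 \<Longrightarrow> cmod z < d2 \<Longrightarrow>
      \<bar>W z - W 0 - a * (cmod z)\<^sup>2\<bar> \<le> \<bar>a\<bar> / 2 * (cmod z)\<^sup>2"
    using smallo_at_0E[OF W, of "\<bar>a\<bar> / 2"] a by (auto simp: norm_power)
  define d where "d = min r (min d1 d2)"
  have d: "d > 0" "d \<le> r" "d \<le> d1" "d \<le> d2" using r d1 d2 by (auto simp: d_def)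
  \<comment> \<open>From radius \<open>d / 4\<close> the factor 2 keeps orbits below
    \<open>d / 2\<close>; one more application of \<open>G\<close> then stays below
    \<open>d\<close>, where the estimates on \<open>W\<close> are valid.\<close>
  define X where "X = ball 0 (d / 4) - {0 :: complex}"
  have Wb: "\<bar>a\<bar> / 2 * (cmod z)\<^sup>2 \<le> \<bar>W z - W 0\<bar>" "\<bar>W z - W 0\<bar> \<le> 3 / 2 * \<bar>a\<bar> * (cmod z)\<^sup>2"
    if "z \<noteq> 0" "cmod z < d" for z
  proof -
    have "\<bar>W z - W 0 - a * (cmod z)\<^sup>2\<bar> \<le> \<bar>a\<bar> / 2 * (cmod z)\<^sup>2"
      using that d by (intro d2(2)) auto
    moreover have "\<bar>a * (cmod z)\<^sup>2\<bar> = \<bar>a\<bar> * (cmod z)\<^sup>2" by (simp add: abs_mult)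
    ultimately show "\<bar>a\<bar> / 2 * (cmod z)\<^sup>2 \<le> \<bar>W z - W 0\<bar>" "\<bar>W z - W 0\<bar> \<le> 3 / 2 * \<bar>a\<bar> * (cmod z)\<^sup>2"
      by linarith+
  qed
  \<comment> \<open>The values of \<open>W - W 0\<close> lie between 1/2 and 3/2 of |a| |z|^2, so
    moduli on one level differ by at most the factor sqrt 3, which is below 2.\<close>
  have compare: "cmod w \<le> 2 * cmod z" if "z \<noteq> 0" "w \<noteq> 0" "cmod z < d" "cmod w < d" "W w = W z" for z w
  proof -
    have "\<bar>a\<bar> / 2 * (cmod w)\<^sup>2 \<le> 3 / 2 * \<bar>a\<bar> * (cmod z)\<^sup>2"
      using Wb(1)[of w] Wb(2)[of z] that by linarith
    then have "\<bar>a\<bar> * (cmod w)\<^sup>2 \<le> \<bar>a\<bar> * (3 * (cmod z)\<^sup>2)" by (simp add: mult_ac)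
    then have "(cmod w)\<^sup>2 \<le> 3 * (cmod z)\<^sup>2" using a by simp
    also have "\<dots> \<le> (2 * cmod z)\<^sup>2" by (simp add: power_mult_distrib)
    finally show ?thesis by (rule power2_le_imp_le) simp
  qed
  have G_nz: "G z \<noteq> 0" if "z \<noteq> 0" "cmod z < d" for z
    using slit[of z] that d by auto
  have orbit: "(G ^^ k) z \<noteq> 0 \<and> cmod ((G ^^ k) z) < d / 2 \<and> W ((G ^^ k) z) = W z \<and>
      cmod z / 2 \<le> cmod ((G ^^ k) z) \<and> cmod ((G ^^ k) z) \<le> 2 * cmod z" if "z \<in> X" for z k
  proof (induction k)
    case 0
    have "cmod z < d / 4" "z \<noteq> 0" using that by (auto simp: X_def)
    moreover have "0 \<le> cmod z" by simp
    ultimately have "cmod z < d / 2" by linarith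
    then show ?case using \<open>z \<noteq> 0\<close> by simp
  next
    case (Suc k)
    let ?w = "(G ^^ k) z"
    have z: "z \<noteq> 0" "cmod z < d / 4" using that by (auto simp: X_def)
    have w: "?w \<noteq> 0" "cmod ?w < d / 2" "W ?w = W z" using Suc by auto
    have 1: "G ?w \<noteq> 0" using G_nz[of ?w] w d by auto
    have 2: "cmod (G ?w) < d" using Gle[of ?w] w d by auto
    have 3: "W (G ?w) = W z" using inv[of ?w] w d by simp
    have 4: "cmod (G ?w) \<le> 2 * cmod z" "cmod z \<le> 2 * cmod (G ?w)"
      using compare[of z "G ?w"] compare[of "G ?w" z] z 1 2 3 d by auto
    then show ?case using 1 3 z by simp
  qed
  have in_ball: "(G ^^ k) z \<in> ball 0 r" if "z \<in> X" for z k
    using orbit[OF that, of k] d by auto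
  have contG: "continuous_on X (G ^^ k)" for k
  proof (induction k)
    case (Suc k)
    have "continuous_on X (G \<circ> (G ^^ k))"
      by (intro continuous_on_compose Suc continuous_on_subset[OF cont]) (use in_ball in auto)
    then show ?case by simp
  qed (simp add: continuous_on_id)
  have contL: "continuous_on X (\<lambda>z. L ((G ^^ k) z))" for k
    unfolding L_def
  proof (intro continuous_on_Ln' continuous_on_divide continuous_on_mult continuous_on_const contG)
    show "continuous_on X (\<lambda>z. G ((G ^^ k) z))" using contG[of "Suc k"] by (simp add: comp_def)
    show "\<forall>z\<in>X. \<mu> * (G ^^ k) z \<noteq> 0" using orbit \<mu>0 by simp
  next
    fix z assume z: "z \<in> X"
    show "G ((G ^^ k) z) / (\<mu> * (G ^^ k) z) \<notin> \<real>\<^sub>\<le>\<^sub>0"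
      using orbit[OF z, of k] d by (intro slit) auto
  qed
  \<comment> \<open>\<open>Im (S q z)\<close> is a real-valued lift of the angle gained in
    \<open>q\<close> steps over that of \<open>\<mu> ^ q\<close>.\<close>
  define S where "S q z = (\<Sum>k<q. L ((G ^^ k) z))" for q z
  have G_exp: "G z = \<mu> * z * exp (L z)" if "z \<noteq> 0" "cmod z < d" for z
    using that G_nz[OF that] \<mu>0 by (simp add: L_def exp_Ln)
  have iter: "(G ^^ q) z = \<mu> ^ q * z * exp (S q z)" if "z \<in> X" for q z
  proof (induction q)
    case (Suc q)
    have "(G ^^ Suc q) z = \<mu> * (G ^^ q) z * exp (L ((G ^^ q) z))"
      using G_exp[of "(G ^^ q) z"] orbit[OF that, of q] d by simp
    also have "\<dots> = \<mu> ^ Suc q * z * exp (S (Suc q) z)"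
      by (subst Suc) (simp add: S_def exp_add)
    finally show ?case .
  qed (simp add: S_def)
  \<comment> \<open>The rotation at the \<open>k\<close>-th orbit point is comparable to its own
    modulus; \<open>orbit\<close> replaces that modulus by the one of \<open>z\<close>, which makes
    the bounds independent of \<open>k\<close>.\<close>
  have L_bounds: "\<bar>b\<bar> / 2 * (cmod z / 2) ^ (2 * n) \<le> \<sigma> * Im (L ((G ^^ k) z))"
       "\<sigma> * Im (L ((G ^^ k) z)) \<le> 3 / 2 * \<bar>b\<bar> * (2 * cmod z) ^ (2 * n)" if z: "z \<in> X" for z k
  proof -
    let ?w = "(G ^^ k) z"
    have "\<bar>Im (L ?w - \<i> * of_real b * of_real (cmod ?w ^ (2 * n)))\<bar> \<le> \<bar>b\<bar> / 2 * cmod ?w ^ (2 * n)"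
      using orbit[OF z, of k] d by (intro order_trans[OF abs_Im_le_cmod] Lb) auto
    moreover have "Im (\<i> * of_real b * of_real (cmod ?w ^ (2 * n))) = b * cmod ?w ^ (2 * n)"
      by (simp flip: of_real_power)
    ultimately have "\<bar>Im (L ?w) - b * cmod ?w ^ (2 * n)\<bar> \<le> \<bar>b\<bar> / 2 * cmod ?w ^ (2 * n)" by simp
    moreover have "\<bar>\<sigma> * (Im (L ?w) - b * cmod ?w ^ (2 * n))\<bar> = \<bar>Im (L ?w) - b * cmod ?w ^ (2 * n)\<bar>"
      by (simp add: abs_mult \<sigma>)
    moreover have "\<sigma> * (Im (L ?w) - b * cmod ?w ^ (2 * n)) = \<sigma> * Im (L ?w) - \<bar>b\<bar> * cmod ?w ^ (2 * n)"
      unfolding \<sigma>(1)[symmetric] by (simp add: algebra_simps)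
    ultimately have *: "\<bar>b\<bar> / 2 * cmod ?w ^ (2 * n) \<le> \<sigma> * Im (L ?w)"
        "\<sigma> * Im (L ?w) \<le> 3 / 2 * \<bar>b\<bar> * cmod ?w ^ (2 * n)" by linarith+
    have "\<bar>b\<bar> / 2 * (cmod z / 2) ^ (2 * n) \<le> \<bar>b\<bar> / 2 * cmod ?w ^ (2 * n)"
      using orbit[OF z, of k] by (intro mult_left_mono power_mono) auto
    with *(1) show "\<bar>b\<bar> / 2 * (cmod z / 2) ^ (2 * n) \<le> \<sigma> * Im (L ?w)" by linarith
    have "3 / 2 * \<bar>b\<bar> * cmod ?w ^ (2 * n) \<le> 3 / 2 * \<bar>b\<bar> * (2 * cmod z) ^ (2 * n)"
      using orbit[OF z, of k] by (intro mult_left_mono power_mono) auto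
    with *(2) show "\<sigma> * Im (L ?w) \<le> 3 / 2 * \<bar>b\<bar> * (2 * cmod z) ^ (2 * n)" by linarith
  qed
  have S_bounds: "real q * (\<bar>b\<bar> / 2 * (cmod z / 2) ^ (2 * n)) \<le> \<sigma> * Im (S q z)"
       "\<sigma> * Im (S q z) \<le> real q * (3 / 2 * \<bar>b\<bar> * (2 * cmod z) ^ (2 * n))" if z: "z \<in> X" for z q
  proof -
    have S: "\<sigma> * Im (S q z) = (\<Sum>k<q. \<sigma> * Im (L ((G ^^ k) z)))"
      by (simp add: S_def sum_distrib_left)
    show "real q * (\<bar>b\<bar> / 2 * (cmod z / 2) ^ (2 * n)) \<le> \<sigma> * Im (S q z)"
      unfolding S using sum_bounded_below[of "{..<q}", OF L_bounds(1)[OF z]] by simp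
    show "\<sigma> * Im (S q z) \<le> real q * (3 / 2 * \<bar>b\<bar> * (2 * cmod z) ^ (2 * n))"
      unfolding S using sum_bounded_above[of "{..<q}", OF L_bounds(2)[OF z]] by simp
  qed

  define \<rho> where "\<rho> = d / 8"
  have \<rho>: "\<rho> > 0" "\<rho> < d / 4" using d by (auto simp: \<rho>_def)
  \<comment> \<open>The lower bound for the rotation per step of orbits that start on the circle of
    radius \<open>\<rho>\<close>.\<close>
  define \<kappa> where "\<kappa> = \<bar>b\<bar> / 2 * (\<rho> / 2) ^ (2 * n)"
  have \<kappa>: "\<kappa> > 0" using b \<rho> by (simp add: \<kappa>_def)
  obtain q :: nat where q: "2 * pi < real q * \<kappa>" using reals_Archimedean3[OF \<kappa>] by blast
  have q0: "q > 0" using q pi_gt_zero by (cases q) auto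
  \<comment> \<open>The rotation that undoes \<open>\<mu> ^ q\<close>. It is taken in (0, 2 pi],
    with 2 pi in place of 0, so that small rotations near 0 are below it and those at radius
    \<open>\<rho>\<close> above it.\<close>
  obtain \<tau> where \<tau>: "0 < \<tau>" "\<tau> \<le> 2 * pi" "\<mu> ^ q * cis (\<sigma> * \<tau>) = 1"
  proof -
    define w where "w = (if \<sigma> = 1 then inverse (\<mu> ^ q) else \<mu> ^ q)"
    have "cmod w = 1" by (simp add: w_def norm_inverse norm_power \<mu>)
    then have w: "w = cis (Arg2pi w)" using Arg2pi_eq[of w] by (simp add: cis_conv_exp)
    define \<tau> where "\<tau> = (if Arg2pi w = 0 then 2 * pi else Arg2pi w)"
    have "0 < \<tau>" "\<tau> \<le> 2 * pi" using Arg2pi_ge_0[of w] Arg2pi_lt_2pi[of w] by (auto simp: \<tau>_def)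
    moreover have c: "cis \<tau> = w" using w by (auto simp: \<tau>_def)
    have "\<mu> ^ q * cis (\<sigma> * \<tau>) = 1"
    proof (cases "\<sigma> = 1")
      case True
      then show ?thesis using c \<mu>0 by (simp add: w_def)
    next
      case False
      then have "\<sigma> = -1" using \<sigma> by simp
      then have "cis (\<sigma> * \<tau>) = inverse w" by (simp add: c[symmetric] flip: cis_inverse)
      then show ?thesis using False \<mu>0 by (simp add: w_def)
    qed
    ultimately show ?thesis using that by blast
  qed
  have "((\<lambda>t. real q * (3 / 2 * \<bar>b\<bar> * (2 * t) ^ (2 * n))) \<longlongrightarrow> real q * (3 / 2 * \<bar>b\<bar> * (2 * 0) ^ (2 * n))) (at_right 0)"
    by (intro tendsto_intros)
  then have "eventually (\<lambda>t. real q * (3 / 2 * \<bar>b\<bar> * (2 * t) ^ (2 * n)) < \<tau>) (at_right 0)"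
    by (rule order_tendstoD(2)) (use n \<tau> in \<open>simp add: power_0_left\<close>)
  then have "eventually (\<lambda>t. real q * (3 / 2 * \<bar>b\<bar> * (2 * t) ^ (2 * n)) < \<tau> \<and> t \<in> {0<..<\<rho>}) (at_right 0)"
    using eventually_at_right_real[OF \<rho>(1)] by (rule eventually_conj)
  then obtain t0 where t0: "0 < t0" "t0 < \<rho>" "real q * (3 / 2 * \<bar>b\<bar> * (2 * t0) ^ (2 * n)) < \<tau>"
    by (auto dest!: eventually_happens'[rotated])
  let ?Z = "{z. (\<forall>k. (G ^^ k) z \<in> ball 0 r) \<and> (G ^^ q) z = z}"
  have periodic: "\<exists>z\<in>?Z. sgn z = u" if u: "cmod u = 1" for u
  proof -
    have X: "t *\<^sub>R u \<in> X" if "t \<in> {t0..\<rho>}" for t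
      using that t0 \<rho> u by (auto simp: X_def)
    have "continuous_on {t0..\<rho>} (\<lambda>t. \<sigma> * Im (S q (t *\<^sub>R u)))"
      unfolding S_def
      by (intro continuous_intros continuous_on_compose2[OF contL]) (use X in auto)
    moreover have "\<sigma> * Im (S q (t0 *\<^sub>R u)) \<le> \<tau>"
      using S_bounds(2)[OF X[of t0], of q] t0 u by auto
    moreover have "\<tau> \<le> \<sigma> * Im (S q (\<rho> *\<^sub>R u))"
      using S_bounds(1)[OF X[of \<rho>], of q] t0 \<rho> u q \<tau> by (auto simp: \<kappa>_def)
    ultimately obtain t where t: "t \<in> {t0..\<rho>}" "\<sigma> * Im (S q (t *\<^sub>R u)) = \<tau>"
      using IVT'[of "\<lambda>t. \<sigma> * Im (S q (t *\<^sub>R u))" t0 \<tau> \<rho>] t0 by auto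
    define z where "z = t *\<^sub>R u"
    have z: "z \<in> X" using X t by (simp add: z_def)
    have "Im (S q z) = \<sigma> * \<tau>"
      using t(2) \<sigma>(3) by (metis mult.assoc mult.left_neutral z_def)
    then have "exp (S q z) = exp (Re (S q z)) *\<^sub>R cis (\<sigma> * \<tau>)"
      by (simp add: exp_eq_polar scaleR_conv_of_real)
    then have "(G ^^ q) z = exp (Re (S q z)) *\<^sub>R (\<mu> ^ q * cis (\<sigma> * \<tau>)) * z"
      unfolding iter[OF z] by (simp add: mult_ac)
    then have Gq: "(G ^^ q) z = (exp (Re (S q z)) * t) *\<^sub>R u"
      unfolding \<tau>(3) by (simp add: z_def scaleR_conv_of_real)
    \<comment> \<open>So far the image is only known to lie on the same ray, with the modulus
      changed by \<open>exp (Re (S q z))\<close>. Invariance of \<open>W\<close> and its injectivity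
      on the ray force this factor to be 1.\<close>
    have "W ((exp (Re (S q z)) * t) *\<^sub>R u) = W (t *\<^sub>R u)"
      using orbit[OF z, of q] Gq by (simp add: z_def)
    moreover have "exp (Re (S q z)) * t \<in> {0<..<r}"
      using in_ball[OF z, of q] Gq t t0 u by (auto simp: abs_mult)
    moreover have "t \<in> {0<..<r}" using t t0 \<rho> d by auto
    ultimately have "exp (Re (S q z)) * t = t" using inj[OF u] by (auto dest: inj_onD)
    then have "(G ^^ q) z = z" using Gq by (simp add: z_def)
    then have "z \<in> ?Z" using in_ball[OF z] by blast
    moreover have "sgn z = u" using u t t0 by (simp add: z_def sgn_scaleR sgn_div_norm)
    ultimately show ?thesis by blast
  qed
  \<comment> \<open>Directions alone separate the points found: \<open>sgn\<close> maps
    \<open>?Z\<close> onto the unit circle.\<close>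
  have "infinite ?Z"
  proof
    assume "finite ?Z"
    then have "finite (sgn ` ?Z)" by simp
    moreover have "sphere 0 1 \<subseteq> sgn ` ?Z" using periodic by force
    ultimately have "finite (sphere (0::complex) 1)" by (rule rev_finite_subset)
    moreover have "connected (sphere (0::complex) 1)" by (rule connected_sphere) simp
    ultimately have "sphere (0::complex) 1 = {} \<or> (\<exists>x. sphere (0::complex) 1 = {x})"
      using connected_finite_iff_sing by blast
    moreover have "(1::complex) \<in> sphere 0 1" "(-1::complex) \<in> sphere 0 1" by auto
    ultimately have "(1::complex) = -1" by (metis empty_iff singletonD)
    then show False by simp
  qed
  with q0 that show ?thesis by blast
qed

section \<open>From the normal form back to the planar map\<close>

text \<open>Polarization: evaluate the form at \<open>b\<close>, \<open>c\<close> and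
  \<open>b + c\<close>.\<close>

lemma diagonal_zero_imp_form_zero:
  fixes D :: "'a::euclidean_space \<Rightarrow> 'a \<Rightarrow> real"
  assumes lin: "\<And>b. b \<in> Basis \<Longrightarrow> linear (D b)"
    and sym: "\<And>b c. b \<in> Basis \<Longrightarrow> c \<in> Basis \<Longrightarrow> D b c = D c b"
    and zero: "\<And>w. (\<Sum>b\<in>Basis. (w \<bullet> b) * D b w) = 0"
    and bc: "b \<in> Basis" "c \<in> Basis"
  shows "D b c = 0"
proof -
  have pick: "(\<Sum>e\<in>Basis. (b \<bullet> e) * D e w) = D b w" if "b \<in> Basis" for b w
    using that by (simp add: inner_Basis if_distrib[of "\<lambda>x. x * _"] cong: if_cong)
  have diag: "D b b = 0" if "b \<in> Basis" for b using zero[of b] pick[OF that] by simp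
  have "(\<Sum>e\<in>Basis. ((b + c) \<bullet> e) * D e (b + c)) = D b (b + c) + D c (b + c)"
    using pick[OF bc(1)] pick[OF bc(2)] by (simp add: inner_add_left distrib_right sum.distrib)
  then show ?thesis
    using zero[of "b + c"] diag bc sym[OF bc] lin by (simp add: linear_add)
qed

lemma Ck_on_imp_continuous_on: "Ck_on k f S \<Longrightarrow> continuous_on S f"
  by (cases k)
    (auto intro: differentiable_imp_continuous_within continuous_at_imp_continuous_on)

lemma Ck_on_SucD:
  assumes "Ck_on (Suc k) f S"
  shows "x \<in> S \<Longrightarrow> (f has_derivative frechet_derivative f (at x)) (at x)"
    and "Ck_on k (\<lambda>x. frechet_derivative f (at x) v) S"
  using assms by (auto simp: frechet_derivative_works)

lemma birkhoff_normal_form_first: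
  assumes nf: "birkhoff_normal_form (2 * n + 1) \<mu> B G" and n: "n > 0"
    and B: "\<forall>j\<in>{1..<n}. B j = 0" "B n = \<i> * complex_of_real b"
  shows "(\<lambda>z. G z - \<mu> * z * (1 + \<i> * of_real b * of_real (cmod z ^ (2 * n))))
           \<in> o[at 0](\<lambda>z. complex_of_real (cmod z ^ (2 * n + 1)))"
proof -
  have "(\<Sum>j = 1..n. B j * (z * cnj z) ^ j) = \<i> * of_real b * of_real (cmod z ^ (2 * n))" for z
  proof -
    have "{1..n} = insert n {1..<n}" using n by auto
    then have "(\<Sum>j = 1..n. B j * (z * cnj z) ^ j) = B n * (z * cnj z) ^ n"
      using B(1) by simp
    also have "(z * cnj z) ^ n = of_real (cmod z ^ (2 * n))"
      by (simp only: of_real_power power_mult complex_norm_square[symmetric])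
    finally show ?thesis by (simp only: B(2))
  qed
  moreover have "(2 * n + 1 - 1) div 2 = n" by simp
  ultimately show ?thesis using nf by (simp only: birkhoff_normal_form_def)
qed

lemma twist_normal_form_linear_part:
  fixes G :: "complex \<Rightarrow> complex"
  assumes nf: "(\<lambda>z. G z - \<mu> * z * (1 + \<i> * of_real b * of_real (cmod z ^ (2 * n))))
           \<in> o[at 0](\<lambda>z. complex_of_real (cmod z ^ (2 * n + 1)))" and n: "n > 0"
  shows "(\<lambda>z. G z - \<mu> * z) \<in> o[at 0](\<lambda>z. z)"
proof -
  have pow: "(\<lambda>z. complex_of_real (cmod z ^ (2 * n))) \<in> o[at 0](\<lambda>z. 1)"
  proof (rule smalloI_tendsto)
    have "((\<lambda>z. complex_of_real (cmod z ^ (2 * n)) / 1) \<longlongrightarrow> complex_of_real (cmod 0 ^ (2 * n)) / 1) (at 0)"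
      by (intro tendsto_intros) simp
    then show "((\<lambda>z. complex_of_real (cmod z ^ (2 * n)) / 1) \<longlongrightarrow> 0) (at 0)" using n by (simp add: power_0_left)
  qed simp
  have "(\<lambda>z. complex_of_real (cmod z)) \<in> O[at 0](\<lambda>z. z)" by (intro bigoI[of _ 1]) simp
  from landau_o.small_big_mult[OF pow this]
  have "(\<lambda>z. complex_of_real (cmod z ^ (2 * n + 1))) \<in> o[at 0](\<lambda>z. z)" by (simp add: mult.commute)
  with nf have 1: "(\<lambda>z. G z - \<mu> * z * (1 + \<i> * of_real b * of_real (cmod z ^ (2 * n)))) \<in> o[at 0](\<lambda>z. z)"
    by (rule landau_o.small_trans)
  have "(\<lambda>z. complex_of_real (cmod z ^ (2 * n)) * (\<mu> * \<i> * of_real b * z)) \<in> o[at 0](\<lambda>z. 1 * z)"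
    by (intro landau_o.small_big_mult pow bigoI[of _ "cmod (\<mu> * \<i> * of_real b)"])
       (simp add: norm_mult)
  then have 2: "(\<lambda>z. \<mu> * z * (\<i> * of_real b * of_real (cmod z ^ (2 * n)))) \<in> o[at 0](\<lambda>z. z)"
    by (simp add: mult_ac)
  from sum_in_smallo(1)[OF 1 2] show ?thesis by (simp add: algebra_simps)
qed

text \<open>In the coordinate \<open>z = h x\<close>, the map \<open>G\<close> and the pulled-back
  integral \<open>V (g z)\<close> satisfy the hypotheses of the twist argument. Its periodic orbits
  stay in a ball on which \<open>g\<close> intertwines \<open>G\<close> and \<open>F\<close>, so the
  injective map \<open>g\<close> carries them to periodic orbits of \<open>F\<close> inside
  \<open>D\<close>.\<close>

lemma infinite_periodic_points_near_twist:
  fixes F :: "real^2 \<Rightarrow> real^2" and b :: real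
  assumes B: "first_nonvanishing_birkhoff_constant F p \<mu> n (\<i> * complex_of_real b)"
    and n: "n > 0" and b: "b \<noteq> 0" and \<mu>: "cmod \<mu> = 1" "\<mu> \<noteq> 1" "\<mu> \<noteq> - 1"
    and D: "open D" "p \<in> D" and F: "\<And>x. x \<in> D \<Longrightarrow> isCont F x" "F p = p"
    and int: "locally_integrable_at m D F p" and m: "m \<ge> 2"
  obtains q where "q > 0" "infinite {x. (\<forall>k. (F ^^ k) x \<in> D) \<and> (F ^^ q) x = x}"
proof -
  from B obtain Bk G where conj: "Ck_locally_conjugate (2 * n + 1) F p G"
    and nf0: "birkhoff_normal_form (2 * n + 1) \<mu> Bk G"
    and Bk: "\<forall>j\<in>{1..<n}. Bk j = 0" "Bk n = \<i> * complex_of_real b"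
    unfolding first_nonvanishing_birkhoff_constant_def birkhoff_constants_def by auto
  note nf = birkhoff_normal_form_first[OF nf0 n Bk]
  from conj obtain U h g where U: "open U" "p \<in> U" "open (h ` U)"
    and hom: "homeomorphism U (h ` U) h g" and Ch: "Ck_on (Suc (2 * n)) h U"
    and Cg: "Ck_on (Suc (2 * n)) g (h ` U)" and hp: "h p = 0"
    and ev: "\<forall>\<^sub>F x in nhds p. F x \<in> U \<and> h (F x) = G (h x)"
    unfolding Ck_locally_conjugate_def Suc_eq_plus1 by blast
  from int obtain UV V where UV: "open UV" "p \<in> UV" and CV: "Ck_on m V UV"
    and inv: "\<forall>x\<in>UV \<inter> D. F x \<in> UV \<longrightarrow> V (F x) = V x"
    and crit: "p isolated_in {x \<in> UV. critical_point V x}"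
    and hess: "det (hessian V p) \<noteq> 0"
    unfolding locally_integrable_at_def by blast
  have gh: "g (h x) = x" if "x \<in> U" for x using hom that by (simp add: homeomorphism_def)
  have hg: "h (g z) = z" "g z \<in> U" if "z \<in> h ` U" for z
    using hom that by (auto simp: homeomorphism_def)
  have 0: "0 \<in> h ` U" using U(2) hp by (metis image_eqI)
  have g0: "g 0 = p" using gh[OF U(2)] hp by simp

  define g' where "g' z = frechet_derivative g (at z)" for z
  define V' where "V' x = frechet_derivative V (at x)" for x
  define H where "H b = frechet_derivative (\<lambda>x. V' x b) (at p)" for b
  have dg: "(g has_derivative g' z) (at z)" if "z \<in> h ` U" for z
    using Ck_on_SucD(1)[OF Cg that] by (simp add: g'_def)
  have cont_g': "isCont (\<lambda>z. g' z v) 0" for v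
    using Ck_on_imp_continuous_on[OF Ck_on_SucD(2)[OF Cg, of v]] 0 continuous_on_eq_continuous_at[OF U(3)]
    unfolding g'_def by blast
  from m obtain k where k: "m = Suc (Suc k)" by (auto simp: le_iff_add)
  have dV: "(V has_derivative V' x) (at x)" if "x \<in> UV" for x
    using Ck_on_SucD(1)[OF CV[unfolded k] that] by (simp add: V'_def)
  have dV': "((\<lambda>x. V' x v) has_derivative H v) (at p)" for v
    using Ck_on_SucD(1)[OF Ck_on_SucD(2)[OF CV[unfolded k]] UV(2)] by (simp add: V'_def H_def)
  have V'p: "V' p = (\<lambda>_. 0)"
    using crit by (auto simp: isolated_in_def critical_point_def V'_def)
  have H_lin: "linear (H v)" for v using dV'[of v] by (rule has_derivative_linear)
  have H_sym: "H u v = H v u" for u v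
  proof (rule second_derivative_symmetric[OF _ dV' dV'])
    show "\<forall>\<^sub>F x in nhds p. (V has_derivative V' x) (at x)"
      using UV dV eventually_nhds by blast
  qed

  have "\<forall>\<^sub>F x in nhds p. x \<in> UV" "\<forall>\<^sub>F x in nhds p. x \<in> D"
    using UV D by (auto simp: eventually_nhds)
  moreover have "\<forall>\<^sub>F x in nhds p. F x \<in> UV"
  proof -
    have "(F \<longlongrightarrow> F p) (nhds p)"
      using F(1)[OF D(2)] by (simp only: isCont_def tendsto_at_iff_tendsto_nhds)
    then show ?thesis using UV F(2) by (auto dest: topological_tendstoD)
  qed
  ultimately have "\<forall>\<^sub>F x in nhds p. x \<in> UV \<and> x \<in> D \<and> F x \<in> UV \<and> F x \<in> U \<and> h (F x) = G (h x)"
    using ev by eventually_elim blast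
  moreover have "(g \<longlongrightarrow> g 0) (nhds 0)"
    using has_derivative_continuous[OF dg[OF 0]] by (simp only: isCont_def tendsto_at_iff_tendsto_nhds)
  then have "(g \<longlongrightarrow> p) (nhds 0)" unfolding g0 .
  ultimately have "\<forall>\<^sub>F z in nhds 0. g z \<in> UV \<and> g z \<in> D \<and> F (g z) \<in> UV \<and> F (g z) \<in> U
      \<and> h (F (g z)) = G (h (g z))"
    by (rule eventually_compose_filterlim)
  moreover have "\<forall>\<^sub>F z in nhds 0. z \<in> h ` U" using U(3) 0 by (auto simp: eventually_nhds)
  ultimately have "\<forall>\<^sub>F z in nhds 0. z \<in> h ` U \<and> g z \<in> UV \<and> g z \<in> D \<and> F (g z) \<in> UV \<and> F (g z) \<in> U
      \<and> h (F (g z)) = G (h (g z))" by eventually_elim blast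
  \<comment> \<open>\<open>F (g z) \<in> U\<close> allows \<open>g\<close> to undo \<open>h\<close>
    in \<open>G z = h (F (g z))\<close>, which yields the conjugacy
    \<open>g (G z) = F (g z)\<close>.\<close>
  then obtain r where r: "r > 0" and ball: "\<And>z. z \<in> ball 0 r \<Longrightarrow> z \<in> h ` U \<and> g z \<in> UV \<and> g z \<in> D
      \<and> F (g z) \<in> UV \<and> F (g z) \<in> U \<and> h (F (g z)) = G (h (g z))"
    by (auto simp: eventually_nhds_metric dist_commute)
  have G: "G z = h (F (g z))" "g (G z) = F (g z)" if "z \<in> ball 0 r" for z
    using ball[OF that] gh hg by (metis, metis)
  have contG: "continuous_on (ball 0 r) G"
  proof (rule continuous_on_eq)
    show "continuous_on (ball 0 r) (\<lambda>z. h (F (g z)))"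
    proof (intro continuous_at_imp_continuous_on ballI)
      fix z :: complex assume z: "z \<in> ball 0 r"
      have "isCont g z" using has_derivative_continuous[OF dg] ball[OF z] by blast
      moreover have "isCont F (g z)" using F ball[OF z] by blast
      ultimately have "isCont (\<lambda>z. F (g z)) z" by (rule isCont_o2)
      moreover have "isCont h (F (g z))"
        using Ck_on_imp_continuous_on[OF Ch] ball[OF z] continuous_on_eq_continuous_at[OF U(1)] by blast
      ultimately show "isCont (\<lambda>z. h (F (g z))) z" by (rule isCont_o2)
    qed
  qed (use G in auto)

  define W where "W z = V (g z)" for z
  define W' where "W' z v = V' (g z) (g' z v)" for z v
  have W_inv: "W (G z) = W z" if "z \<in> ball 0 r" for z
    using G[OF that] ball[OF that] inv by (auto simp: W_def)
  have dW: "(W has_derivative W' z) (at z)" if "z \<in> ball 0 r" for z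
    unfolding W_def W'_def
    by (rule has_derivative_compose[OF dg dV]) (use ball[OF that] in auto)

  define A where "A = g' 0"
  have A_lin: "linear A" unfolding A_def by (rule has_derivative_linear[OF dg[OF 0]])
  \<comment> \<open>Differentiating \<open>g (h x) = x\<close> at \<open>p\<close> gives a right
    inverse of \<open>A\<close>.\<close>
  have A_surj: "\<exists>z. w = A z" for w
  proof -
    have dh: "(h has_derivative frechet_derivative h (at p)) (at p)"
      using Ck_on_SucD(1)[OF Ch U(2)] .
    have "((\<lambda>x. g (h x)) has_derivative (\<lambda>v. A (frechet_derivative h (at p) v))) (at p)"
      unfolding A_def using has_derivative_compose[OF dh] dg[OF 0] hp by simp
    then have "((\<lambda>x. x) has_derivative (\<lambda>v. A (frechet_derivative h (at p) v))) (at p)"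
      by (rule has_derivative_transform_within_open[OF _ U(1,2)]) (simp add: gh)
    then have "(\<lambda>v. A (frechet_derivative h (at p) v)) = (\<lambda>v. v)"
      using has_derivative_unique has_derivative_ident by blast
    then show ?thesis by metis
  qed
  \<comment> \<open>The Hessian form of \<open>V\<close> at \<open>p\<close>, pulled back by
    \<open>A\<close>; \<open>c\<close> is its bilinear version, which supplies the three
    coefficients of \<open>q\<close>.\<close>
  define q where "q z = (\<Sum>e\<in>Basis. (A z \<bullet> e) * H e (A z))" for z
  define c where "c u v = (\<Sum>e\<in>Basis. (A u \<bullet> e) * H e (A v))" for u v
  have A_eq: "A z = Re z *\<^sub>R A 1 + Im z *\<^sub>R A \<i>" for z
  proof -
    have "A z = A (Re z *\<^sub>R 1 + Im z *\<^sub>R \<i>)" by (rule arg_cong[of _ _ A]) (simp add: complex_eq_iff)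
    then show ?thesis using A_lin by (simp add: linear_add linear_scale)
  qed
  have q_eq: "q z = c 1 1 * (Re z)\<^sup>2 + (c 1 \<i> + c \<i> 1) * Re z * Im z + c \<i> \<i> * (Im z)\<^sup>2" for z
    unfolding q_def c_def sum_distrib_right sum.distrib[symmetric]
  proof (rule sum.cong[OF refl])
    fix e
    have "H e (A z) = Re z * H e (A 1) + Im z * H e (A \<i>)"
      unfolding A_eq[of z] using H_lin[of e] by (simp add: linear_add linear_scale)
    moreover have "A z \<bullet> e = Re z * (A 1 \<bullet> e) + Im z * (A \<i> \<bullet> e)"
      unfolding A_eq[of z] by (simp add: inner_add_left)
    ultimately show "(A z \<bullet> e) * H e (A z) = (A 1 \<bullet> e) * H e (A 1) * (Re z)\<^sup>2 +
        ((A 1 \<bullet> e) * H e (A \<i>) + (A \<i> \<bullet> e) * H e (A 1)) * Re z * Im z + (A \<i> \<bullet> e) * H e (A \<i>) * (Im z)\<^sup>2"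
      by (simp add: algebra_simps power2_eq_square)
  qed
  have q_hom: "q (t *\<^sub>R z) = t\<^sup>2 * q z" for t :: real and z
    by (simp add: q_eq algebra_simps power2_eq_square)
  have q_cont: "continuous_on UNIV q" unfolding q_eq by (intro continuous_intros)
  have ball_ev: "\<forall>\<^sub>F z in at 0. z \<in> ball 0 r" using r by (intro eventually_at_in_open') auto
  have rad: "(\<lambda>z. W' z z - q z) \<in> o[at 0](\<lambda>z. (norm z)\<^sup>2)"
    unfolding W'_def q_def A_def
  proof (rule radial_derivative_expansion)
    show "\<forall>\<^sub>F z in at 0. linear (g' z)"
      using ball_ev by eventually_elim (use ball dg has_derivative_linear in blast)
    show "\<forall>\<^sub>F z in at 0. linear (V' (g z))"
      using ball_ev by eventually_elim (use ball dV has_derivative_linear in blast)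
  qed (use dg[OF 0] cont_g' V'p dV' g0 in auto)
  have exp_W: "(\<lambda>z. W z - W 0 - q z / 2) \<in> o[at 0](\<lambda>z. (norm z)\<^sup>2)"
    by (rule radial_derivative_imp_expansion[OF r dW rad q_hom])
  have "q (\<mu> * z) = q z" for z
  proof (rule leading_form_invariant[OF q_cont q_hom exp_W])
    show "\<forall>\<^sub>F z in at 0. W (G z) = W z" using ball_ev by eventually_elim (rule W_inv)
    show "(\<lambda>z. G z - \<mu> * z) \<in> o[at 0](\<lambda>z. z)" by (rule twist_normal_form_linear_part[OF nf n])
  qed
  then have q_norm: "q z = c 1 1 * (cmod z)\<^sup>2" for z
    using rotation_invariant_quadratic_form[OF _ \<mu>, of "c 1 1" "c 1 \<i> + c \<i> 1" "c \<i> \<i>" z]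
    unfolding q_eq by blast
  \<comment> \<open>Otherwise \<open>q\<close> vanishes, hence, \<open>A\<close> being onto, so does
    the Hessian form on all vectors; polarization then makes the Hessian zero, against
    \<open>hess\<close>.\<close>
  have c_nz: "c 1 1 \<noteq> 0"
  proof
    assume "c 1 1 = 0"
    then have "q z = 0" for z by (simp add: q_norm)
    then have "(\<Sum>e\<in>Basis. (w \<bullet> e) * H e w) = 0" for w
      using A_surj[of w] by (auto simp: q_def)
    then have "H e f = 0" if "e \<in> Basis" "f \<in> Basis" for e f
      using diagonal_zero_imp_form_zero[of H, OF H_lin H_sym _ that] by blast
    then have "hessian V p $ i $ j = 0" for i j
      by (simp add: hessian_def H_def V'_def)
    then show False using hess by (simp add: det_2)
  qed
  obtain d where d: "d > 0" "\<And>u. norm u = 1 \<Longrightarrow> inj_on (\<lambda>t. W (t *\<^sub>R u)) {0<..<d}"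
    using radial_derivative_imp_inj_on_rays[OF r dW _ c_nz] rad unfolding q_norm by blast
  define s where "s = min r d"
  have s: "s > 0" "s \<le> r" "s \<le> d" using r d by (auto simp: s_def)
  obtain k where k: "k > 0" "infinite {z. (\<forall>j. (G ^^ j) z \<in> ball 0 s) \<and> (G ^^ k) z = z}"
  proof (rule twist_map_infinite_periodic_points[OF \<mu>(1) n b s(1) _ _ nf])
    show "c 1 1 / 2 \<noteq> 0" using c_nz by simp
    show "continuous_on (ball 0 s) G" using contG s by (auto intro: continuous_on_subset)
    show "W (G z) = W z" if "z \<in> ball 0 s" for z using W_inv that s by auto
    show "(\<lambda>z. W z - W 0 - c 1 1 / 2 * (cmod z)\<^sup>2) \<in> o[at 0](\<lambda>z. (cmod z)\<^sup>2)"
      using exp_W by (simp add: q_norm)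
    show "inj_on (\<lambda>t. W (t *\<^sub>R u)) {0<..<s}" if "cmod u = 1" for u
      using d(2)[OF that] s by (auto intro: inj_on_subset)
  qed
  let ?Z = "{z. (\<forall>j. (G ^^ j) z \<in> ball 0 s) \<and> (G ^^ k) z = z}"
  have Z: "(G ^^ j) z \<in> ball 0 r" if "z \<in> ?Z" for z j using that s by (auto intro: less_le_trans)
  have conj_iter: "(F ^^ j) (g z) = g ((G ^^ j) z)" if "z \<in> ?Z" for z j
    by (induction j) (use G(2)[OF Z[OF that]] in auto)
  have "inj_on g ?Z"
  proof (rule inj_on_inverseI)
    show "h (g z) = z" if "z \<in> ?Z" for z using Z[OF that, of 0] ball hg by auto
  qed
  with k(2) have "infinite (g ` ?Z)" using finite_imageD by blast
  moreover have "g ` ?Z \<subseteq> {x. (\<forall>j. (F ^^ j) x \<in> D) \<and> (F ^^ k) x = x}"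
    using conj_iter Z ball by auto
  ultimately have "infinite {x. (\<forall>j. (F ^^ j) x \<in> D) \<and> (F ^^ k) x = x}"
    using infinite_super by blast
  with k(1) that show ?thesis by blast
qed

section \<open>Periodic points of the rational map\<close>

text \<open>The first coordinate of an orbit point is the second coordinate of its predecessor, so a
  \<open>q\<close>-periodic orbit is a \<open>q\<close>-periodic real sequence solving the
  polynomial recurrence. Staying in the domain permits multiplication by the denominator.\<close>

lemma finite_periodic_points_rat_map:
  assumes deg: "degree Q + 1 < degree P" and q: "q > 0"
  shows "finite {x. (\<forall>k. (rat_map P Q ^^ k) x \<in> rat_map_domain Q) \<and> (rat_map P Q ^^ q) x = x}"
    (is "finite ?Per")
proof -
  let ?F = "rat_map P Q"
  \<comment> \<open>Cyclic successor and predecessor; adding \<open>q\<close> before subtracting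
    avoids truncation at \<open>i = 0\<close>.\<close>
  define s t where "s i = Suc i mod q" and "t i = (i + q - 1) mod q" for i
  define S where "S = {y :: nat \<Rightarrow> real. \<forall>i\<in>{..<q}. poly P (y i) = poly Q (y i) * (y (s i) + y (t i))}"
  have fin: "finite ((\<lambda>y. y i) ` S)" if "i < q" for i
    unfolding S_def
    by (rule finite_coordinates_of_polynomial_recurrence[OF _ deg]) (use that q in \<open>auto simp: s_def t_def\<close>)
  define Y where "Y x k = (?F ^^ k) x $ 2" for x k
  have F1: "(?F ^^ Suc k) x $ 1 = Y x k" for x k
    by (simp add: Y_def rat_map_def)
  have Y_S: "Y x \<in> S" if x: "x \<in> ?Per" for x
    unfolding S_def
  proof (intro CollectI ballI)
    fix i assume "i \<in> {..<q}"
    have per: "Y x (k mod q) = Y x k" for k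
      using funpow_mod_eq[of q ?F x k] x by (simp add: Y_def)
    \<comment> \<open>The index before \<open>i\<close>, shifted by one period so that it is a
      natural number for \<open>i = 0\<close> as well.\<close>
    define k where "k = i + q - 1"
    have k: "Suc k = i + q" using q by (simp add: k_def)
    have "Y x (Suc (Suc k)) = - Y x k + poly P (Y x (Suc k)) / poly Q (Y x (Suc k))"
      using F1[of k x] by (simp add: Y_def rat_map_def)
    moreover have "Y x (Suc k) = Y x i" using per[of "Suc k"] per[of i] by (simp add: k)
    moreover have "Y x (Suc (Suc k)) = Y x (s i)"
      using per[of "Suc (Suc k)"] by (simp add: k s_def mod_simps flip: add_Suc)
    moreover have "Y x k = Y x (t i)" using per[of k] by (simp add: k_def t_def)
    moreover have "poly Q (Y x i) \<noteq> 0" using x by (auto simp: rat_map_domain_def Y_def)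
    ultimately show "poly P (Y x i) = poly Q (Y x i) * (Y x (s i) + Y x (t i))"
      by (simp add: field_simps)
  qed
  have "(x $ 1, x $ 2) \<in> ((\<lambda>y. y (q - 1)) ` S) \<times> ((\<lambda>y. y 0) ` S)" if x: "x \<in> ?Per" for x
  proof -
    have "x $ 1 = Y x (q - 1)" using F1[of "q - 1" x] x q by simp
    moreover have "x $ 2 = Y x 0" by (simp add: Y_def)
    ultimately show ?thesis using Y_S[OF x] by auto
  qed
  then have "(\<lambda>x. (x $ 1, x $ 2)) ` ?Per \<subseteq> ((\<lambda>y. y (q - 1)) ` S) \<times> ((\<lambda>y. y 0) ` S)" by blast
  moreover have "finite (((\<lambda>y. y (q - 1)) ` S) \<times> ((\<lambda>y. y 0) ` S))" using fin q by auto
  moreover have "inj_on (\<lambda>x :: real^2. (x $ 1, x $ 2)) ?Per"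
    by (auto simp: inj_on_def vec_eq_iff forall_2)
  ultimately show ?thesis by (meson finite_imageD finite_subset)
qed

lemma open_rat_map_domain: "open (rat_map_domain Q)"
  unfolding rat_map_domain_def by (intro open_Collect_neq continuous_intros)

lemma isCont_rat_map:
  assumes "x \<in> rat_map_domain Q"
  shows "isCont (rat_map P Q) x"
  unfolding isCont_def
proof (rule vec_tendstoI)
  have "((\<lambda>x. rat_map P Q x $ 1) \<longlongrightarrow> rat_map P Q x $ 1) (at x)"
    "((\<lambda>x. rat_map P Q x $ 2) \<longlongrightarrow> rat_map P Q x $ 2) (at x)"
    using assms by (auto simp: rat_map_def rat_map_domain_def intro!: tendsto_intros)
  then show "((\<lambda>x. rat_map P Q x $ i) \<longlongrightarrow> rat_map P Q x $ i) (at x)" for i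
    using exhaust_2[of i] by auto
qed

theorem theorem8:
  fixes P Q :: "real poly" and p :: "real^2" and \<mu> :: complex and n :: nat and b :: real
  assumes "Q \<noteq> 0"
    and "rat_degree P Q > 1"
    and "elliptic_fixed_point (rat_map_domain Q) (rat_map P Q) p \<mu>"
    and "\<not> resonant (2 * n + 1) \<mu>"
    and "0 < n"
    and "b \<noteq> 0"
    and "first_nonvanishing_birkhoff_constant (rat_map P Q) p \<mu> n (\<i> * complex_of_real b)"
  shows "\<not> locally_integrable_at (2 * n + 4) (rat_map_domain Q) (rat_map P Q) p"
proof
  assume int: "locally_integrable_at (2 * n + 4) (rat_map_domain Q) (rat_map P Q) p"
  have p: "p \<in> rat_map_domain Q" "rat_map P Q p = p" and \<mu>: "cmod \<mu> = 1" "\<mu> \<noteq> 1" "\<mu> \<noteq> - 1"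
    using assms(3) by (auto simp: elliptic_fixed_point_def)
  obtain q where "q > 0"
    "infinite {x. (\<forall>k. (rat_map P Q ^^ k) x \<in> rat_map_domain Q) \<and> (rat_map P Q ^^ q) x = x}"
    by (rule infinite_periodic_points_near_twist[OF assms(7,5,6) \<mu> open_rat_map_domain p(1)
          isCont_rat_map p(2) int]) auto
  moreover have "degree Q + 1 < degree P" using assms(2) by (simp add: rat_degree_def)
  ultimately show False using finite_periodic_points_rat_map by blast
qed

end
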